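(* Let $0<k'<1$, $k=\sqrt{1-k'^2}$, let $K$ and $K'$ be the complete elliptic integrals of the first kind of moduli $k$ and $k'$ respectively, and put $v=\exp(-\pi K/K')$. Define for $n=0,1,2,\dots$ $$b_n=\begin{cases}(k'+3)n/2+1,& n\equiv 0\pmod 4,\\ (3k'+1)n/2+(k'+1)/2,& n\equiv 1\pmod 4,\\ (3k'+1)n/2+k',& n\equiv 2\pmod 4,\\ (k'+3)n/2+(k'+1)/2,& n\equiv 3\pmod 4,\end{cases}\qquad u_n=\begin{cases}k'(k'+1)n^2,& n\equiv 0\pmod 4,\\ 2k'n^2,& n\equiv 1,3\pmod 4,\\ (1+k')n^2,& n\equiv 2\pmod 4,\end{cases}$$ and let $P_n(x)$ be the monic polynomials with $P_0=1$, $P_1(x)=x-b_0$, $P_{n+1}(x)+b_nP_n(x)+u_nP_{n-1}(x)=xP_n(x)$. Let $$x_s=\frac{\pi(s-1/2)}{K'},\qquad M_s=\frac{\pi}{k'K'}\,\frac{v^{-(s-1/2)/2}}{v^{s-1/2}+v^{1/2-s}},\qquad s\in\mathbb{Z}.$$ Then $\sum_{s=-\infty}^{\infty}M_sP_n(x_s)P_m(x_s)=h_n\delta_{nm}$ for all $n,m\ge0$, where $h_n=c_0u_1u_2\cdots u_n$ with $c_0=\sqrt{\frac{1+k'}{k'}}$. *)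

theory Defs
  imports "HOL-Analysis.Analysis"
begin

definition ellK :: "real \<Rightarrow> real" where
  "ellK k = integral {0..pi/2} (\<lambda>\<theta>. 1 / sqrt (1 - k^2 * (sin \<theta>)^2))"

definition bcoef :: "real \<Rightarrow> nat \<Rightarrow> real" where
  "bcoef kp n =
    (if n mod 4 = 0 then (kp + 3) * real n / 2 + 1
     else if n mod 4 = 1 then (3 * kp + 1) * real n / 2 + (kp + 1) / 2
     else if n mod 4 = 2 then (3 * kp + 1) * real n / 2 + kp
     else (kp + 3) * real n / 2 + (kp + 1) / 2)"

definition ucoef :: "real \<Rightarrow> nat \<Rightarrow> real" where
  "ucoef kp n =
    (if n mod 4 = 0 then kp * (kp + 1) * (real n)^2
     else if n mod 4 = 2 then (1 + kp) * (real n)^2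
     else 2 * kp * (real n)^2)"

fun Ppoly :: "real \<Rightarrow> nat \<Rightarrow> real \<Rightarrow> real" where
  "Ppoly kp 0 x = 1"
| "Ppoly kp (Suc 0) x = x - bcoef kp 0"
| "Ppoly kp (Suc (Suc n)) x =
     (x - bcoef kp (Suc n)) * Ppoly kp (Suc n) x - ucoef kp (Suc n) * Ppoly kp n x"

end

theory Submission
  imports Defs
begin

text \<open>
  Write \<open>l = pi K / K'\<close>. The weights are chosen so that \<open>\<Sum> M_s exp (x_s z) = nc (z + K/2; k)\<close>, and
  \<open>P_n(d/dz)\<close> applied to this function is \<open>n!\<close> times a product \<open>T ^ (n div 4) * E_(n mod 4)\<close> of explicit
  polynomials in \<open>sc\<close>, \<open>nc\<close>, \<open>dc\<close>, because the recurrence for the \<open>P_n\<close> matches the derivative of that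
  product. As \<open>T\<close>, \<open>E_1\<close>, \<open>E_2\<close>, \<open>E_3\<close> vanish at the quarter period \<open>K/2\<close>, all \<open>P_n\<close> with \<open>n > 0\<close> have
  mean zero, which together with the three-term recurrence gives orthogonality.

  The Fourier expansion of \<open>nc\<close> is obtained without theta function theory. The bilateral series
  \<open>c = \<Sum> exp (t w) / cosh (t l)\<close> and \<open>s = \<Sum> exp (t w) / sinh (t l)\<close> over half-integers and
  \<open>d = \<Sum> exp (n w) / cosh (n l)\<close> over integers satisfy \<open>2 c' = s d\<close>, \<open>2 s' = c d\<close>, \<open>2 d' = s c\<close>: by
  \<open>coth a + tanh b = cosh (a + b) / (sinh a cosh b)\<close> the convolution of the coefficients telescopes.
  Integrating this system along the real axis up to the blow-up at \<open>w = l\<close>, and along the imaginary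
  axis up to \<open>w = i pi\<close>, identifies \<open>l\<close> and \<open>pi\<close> with complete elliptic integrals for the modulus
  \<open>c(0) / d(0)\<close>; by monotonicity of \<open>K / K'\<close> this modulus is \<open>k'\<close>.
\<close>

section \<open>Bilateral exponential series in a vertical strip\<close>

lemma exp_mult_shift:
  fixes t x e :: real
  shows "exp (t * (x + e)) = exp (t * x) * exp (t * e)"
    and "exp (t * (x - e)) = exp (t * x) * exp (- (t * e))"
  by (simp_all add: exp_add[symmetric] distrib_left right_diff_distrib)

definition shifted_ints :: "real \<Rightarrow> real set" where
  "shifted_ints a = range (\<lambda>n::int. real_of_int n + a)"

abbreviation half_ints :: "real set" where
  "half_ints \<equiv> shifted_ints (- (1/2))"

text \<open>Indexing by the exponent itself makes differentiation the coefficient map from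
  \<open>a t\<close> to \<open>t * a t\<close>, and treats integer and half-integer frequencies
  alike.\<close>

definition exp_series :: "real set \<Rightarrow> (real \<Rightarrow> real) \<Rightarrow> complex \<Rightarrow> complex" where
  "exp_series A a w = (\<Sum>\<^sub>\<infinity>t\<in>A. of_real (a t) * exp (of_real t * w))"

text \<open>The modulus of a term depends on \<open>Re w\<close> only, so absolute convergence in an
  open vertical strip can be tested at real points.\<close>

definition strip_summable :: "real \<Rightarrow> real set \<Rightarrow> (real \<Rightarrow> real) \<Rightarrow> bool" where
  "strip_summable l A a \<longleftrightarrow>
     (\<forall>x. \<bar>x\<bar> < l \<longrightarrow> (\<lambda>t. \<bar>a t\<bar> * exp (t * x)) summable_on A)"

lemma norm_exp_term:
  "norm (of_real (a t) * exp (of_real t * w) :: complex) = \<bar>a t\<bar> * exp (t * Re w)"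
  by (simp add: norm_mult)

lemma exp_series_abs_summable:
  assumes "strip_summable l A a" "\<bar>Re w\<bar> < l"
  shows "(\<lambda>t. norm (of_real (a t) * exp (of_real t * w) :: complex)) summable_on A"
  unfolding norm_exp_term using assms by (simp add: strip_summable_def)

lemma exp_series_has_sum:
  assumes "strip_summable l A a" "\<bar>Re w\<bar> < l"
  shows "((\<lambda>t. of_real (a t) * exp (of_real t * w)) has_sum exp_series A a w) A"
  unfolding exp_series_def
  by (rule has_sum_infsum, rule abs_summable_summable, rule exp_series_abs_summable[OF assms])

text \<open>The strip is open, so there is room for a small shift \<open>e\<close>. The factor
  \<open>t\<close> costs only this shift, as
  \<open>\<bar>t\<bar> \<le> (exp (t * e) + exp (- (t * e))) / e\<close>.\<close>

lemma strip_summable_mult: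
  assumes "strip_summable l A a"
  shows "strip_summable l A (\<lambda>t. t * a t)"
  unfolding strip_summable_def
proof (intro allI impI)
  fix x :: real assume x: "\<bar>x\<bar> < l"
  obtain y where y: "\<bar>x\<bar> < y" "y < l" using dense x by blast
  define e where "e = y - \<bar>x\<bar>"
  have e0: "e > 0" and ee: "\<bar>x\<bar> + e < l" using y by (simp_all add: e_def)
  have e1: "\<bar>x + e\<bar> < l" using e0 ee by linarith
  have e2: "\<bar>x - e\<bar> < l" using e0 ee by linarith
  note e = e0 e1 e2
  have "(\<lambda>t. (1/e) * (\<bar>a t\<bar> * exp (t * (x + e)) + \<bar>a t\<bar> * exp (t * (x - e)))) summable_on A"
    using assms e by (intro summable_on_cmult_right summable_on_add) (auto simp: strip_summable_def)
  then show "(\<lambda>t. \<bar>t * a t\<bar> * exp (t * x)) summable_on A"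
  proof (rule summable_on_comparison_test)
    fix t
    have "e * \<bar>t\<bar> \<le> exp (e * \<bar>t\<bar>)" using exp_ge_add_one_self[of "e * \<bar>t\<bar>"] by linarith
    also have "\<dots> \<le> exp (t * e) + exp (- (t * e))"
      by (cases "t \<ge> 0") (auto simp: mult.commute)
    finally have "\<bar>t\<bar> \<le> (1/e) * (exp (t * e) + exp (- (t * e)))"
      using e by (simp add: field_simps)
    then have "\<bar>t\<bar> * (\<bar>a t\<bar> * exp (t * x)) \<le> (1/e) * (exp (t * e) + exp (- (t * e))) * (\<bar>a t\<bar> * exp (t * x))"
      by (intro mult_right_mono) auto
    also have "\<dots> = (1/e) * (\<bar>a t\<bar> * exp (t * (x + e)) + \<bar>a t\<bar> * exp (t * (x - e)))"
      unfolding exp_mult_shift by (simp only: ring_distribs mult_ac)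
    finally show "\<bar>t * a t\<bar> * exp (t * x) \<le> \<dots>" by (simp add: abs_mult mult.assoc)
  qed simp
qed

lemma strip_summable_cmult:
  assumes "strip_summable l A a"
  shows "strip_summable l A (\<lambda>t. c * a t)"
  unfolding strip_summable_def
proof (intro allI impI)
  fix x :: real assume "\<bar>x\<bar> < l"
  then have "(\<lambda>t. \<bar>c\<bar> * (\<bar>a t\<bar> * exp (t * x))) summable_on A"
    using assms by (intro summable_on_cmult_right) (auto simp: strip_summable_def)
  then show "(\<lambda>t. \<bar>c * a t\<bar> * exp (t * x)) summable_on A"
    by (simp add: abs_mult mult.assoc)
qed

lemma strip_summable_mono:
  assumes "strip_summable l A b" "\<And>t. t \<in> A \<Longrightarrow> \<bar>a t\<bar> \<le> \<bar>b t\<bar>"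
  shows "strip_summable l A a"
  unfolding strip_summable_def
proof (intro allI impI)
  fix x :: real assume "\<bar>x\<bar> < l"
  then have "(\<lambda>t. \<bar>b t\<bar> * exp (t * x)) summable_on A"
    using assms(1) by (auto simp: strip_summable_def)
  then show "(\<lambda>t. \<bar>a t\<bar> * exp (t * x)) summable_on A"
    by (rule summable_on_comparison_test) (auto intro!: mult_right_mono assms(2))
qed

text \<open>Termwise differentiation by a direct estimate: the second-order Taylor remainders of the
  exponentials are summable with a bound that is quadratic in \<open>z - w\<close>.\<close>

lemma exp_series_has_field_derivative:
  assumes a: "strip_summable l A a" and w: "\<bar>Re w\<bar> < l"
  shows "(exp_series A a has_field_derivative exp_series A (\<lambda>t. t * a t) w) (at w)"
proof -
  obtain y where y: "\<bar>Re w\<bar> < y" "y < l" using dense w by blast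
  define e where "e = y - \<bar>Re w\<bar>"
  have e0: "e > 0" and ee: "\<bar>Re w\<bar> + e < l" using y by (simp_all add: e_def)
  have e1: "\<bar>Re w + e\<bar> < l" using e0 ee by linarith
  have e2: "\<bar>Re w - e\<bar> < l" using e0 ee by linarith
  note e = e0 e1 e2
  have aa: "strip_summable l A (\<lambda>t. t * (t * a t))"
    by (intro strip_summable_mult a)
  \<comment> \<open>This dominates \<open>t\<^sup>2 * \<bar>a t\<bar> * exp (t * Re w) * exp
    (\<bar>t\<bar> * e)\<close>. The two exponentials replace the absolute value in the exponent, so
    each half is covered by summability in the strip.\<close>
  define g where "g = (\<lambda>t. \<bar>t * (t * a t)\<bar> * exp (t * (Re w + e)) + \<bar>t * (t * a t)\<bar> * exp (t * (Re w - e)))"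
  have "g summable_on A"
    unfolding g_def using aa e by (intro summable_on_add) (auto simp: strip_summable_def)
  then obtain M where M: "(g has_sum M) A" by (auto simp: summable_on_def)
  have est: "norm (exp_series A a z - exp_series A a w - exp_series A (\<lambda>t. t * a t) w * (z - w))
      \<le> M * (norm (z - w))\<^sup>2" if z: "norm (z - w) < e" for z
  proof -
    define h where "h = z - w"
    have h: "norm h < e" and zh: "z = w + h" using z by (auto simp: h_def)
    have Reh: "\<bar>Re h\<bar> < e" using h abs_Re_le_cmod[of h] by linarith
    have "\<bar>Re z\<bar> < l" using Reh ee e0 unfolding zh plus_complex.sel by linarith
    note s1 = exp_series_has_sum[OF a this]
    note s2 = exp_series_has_sum[OF a w]
    note s3 = exp_series_has_sum[OF strip_summable_mult[OF a] w]
    have s: "((\<lambda>t. (of_real (a t) * exp (of_real t * z) + - 1 * (of_real (a t) * exp (of_real t * w)))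
         + - h * (of_real (t * a t) * exp (of_real t * w))) has_sum
         (exp_series A a z + - 1 * exp_series A a w) + - h * exp_series A (\<lambda>t. t * a t) w) A"
      by (intro has_sum_add has_sum_cmult_right s1 s2 s3)
    have "norm ((exp_series A a z + - 1 * exp_series A a w) + - h * exp_series A (\<lambda>t. t * a t) w)
        \<le> (norm h)\<^sup>2 * M"
    proof (rule norm_infsum_le[OF s has_sum_cmult_right[OF M]])
      fix t assume "t \<in> A"
      have "norm (exp (of_real t * h) - (1 + of_real t * h)) \<le> exp \<bar>Re (of_real t * h)\<bar> * norm (of_real t * h) ^ 2"
        using Taylor_exp[of "of_real t * h" 1] by (simp add: power2_eq_square)
      also have "\<dots> = exp \<bar>t * Re h\<bar> * (t\<^sup>2 * (norm h)\<^sup>2)"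
        by (simp add: norm_mult power_mult_distrib)
      also have "exp \<bar>t * Re h\<bar> \<le> exp (\<bar>t\<bar> * e)"
        using Reh by (auto simp: abs_mult intro!: mult_left_mono)
      also have "exp (\<bar>t\<bar> * e) \<le> exp (t * e) + exp (- (t * e))"
        by (cases "t \<ge> 0") auto
      finally have E: "norm (exp (of_real t * h) - (1 + of_real t * h)) \<le> (exp (t * e) + exp (- (t * e))) * (t\<^sup>2 * (norm h)\<^sup>2)"
        by (simp add: mult_right_mono)
      have "(of_real (a t) * exp (of_real t * z) + - 1 * (of_real (a t) * exp (of_real t * w)))
         + - h * (of_real (t * a t) * exp (of_real t * w))
         = of_real (a t) * exp (of_real t * w) * (exp (of_real t * h) - (1 + of_real t * h))"
        by (simp add: zh algebra_simps exp_add)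
      then have "norm ((of_real (a t) * exp (of_real t * z) + - 1 * (of_real (a t) * exp (of_real t * w)))
         + - h * (of_real (t * a t) * exp (of_real t * w)))
         = (\<bar>a t\<bar> * exp (t * Re w)) * norm (exp (of_real t * h) - (1 + of_real t * h))"
        by (simp only: norm_mult norm_exp_term[unfolded norm_mult])
      also have "\<dots> \<le> (\<bar>a t\<bar> * exp (t * Re w)) * ((exp (t * e) + exp (- (t * e))) * (t\<^sup>2 * (norm h)\<^sup>2))"
        by (intro mult_left_mono E) auto
      also have "\<dots> = (norm h)\<^sup>2 * g t"
        unfolding g_def exp_mult_shift abs_mult by (simp add: algebra_simps power2_eq_square)
      finally show "norm ((of_real (a t) * exp (of_real t * z) + - 1 * (of_real (a t) * exp (of_real t * w)))
         + - h * (of_real (t * a t) * exp (of_real t * w))) \<le> (norm h)\<^sup>2 * g t" .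
    qed
    then show ?thesis by (simp add: h_def algebra_simps)
  qed
  have "((\<lambda>z. M * norm (z - w)) \<longlongrightarrow> M * norm (w - w)) (at w)"
    by (intro tendsto_intros)
  then have lim: "((\<lambda>z. M * norm (z - w)) \<longlongrightarrow> 0) (at w)" by simp
  have "((\<lambda>z. (exp_series A a z - exp_series A a w) / (z - w) - exp_series A (\<lambda>t. t * a t) w) \<longlongrightarrow> 0) (at w)"
  proof (rule Lim_null_comparison[OF _ lim])
    show "\<forall>\<^sub>F z in at w. norm ((exp_series A a z - exp_series A a w) / (z - w) - exp_series A (\<lambda>t. t * a t) w)
          \<le> M * norm (z - w)"
      unfolding eventually_at
    proof (intro exI[of _ e] conjI ballI impI)
      fix z assume z: "z \<noteq> w \<and> dist z w < e"
      then have nz: "norm (z - w) > 0" by simp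
      have "norm ((exp_series A a z - exp_series A a w) / (z - w) - exp_series A (\<lambda>t. t * a t) w)
         = norm ((exp_series A a z - exp_series A a w - exp_series A (\<lambda>t. t * a t) w * (z - w)) / (z - w))"
        using z by (simp add: field_simps)
      also have "\<dots> \<le> (M * (norm (z - w))\<^sup>2) / norm (z - w)"
        unfolding norm_divide using z by (intro divide_right_mono est) (auto simp: dist_norm)
      also have "\<dots> = M * norm (z - w)" using nz by (simp add: power2_eq_square)
      finally show "norm ((exp_series A a z - exp_series A a w) / (z - w) - exp_series A (\<lambda>t. t * a t) w)
          \<le> M * norm (z - w)" .
    qed (use e in auto)
  qed
  then show ?thesis
    by (simp add: has_field_derivative_iff LIM_zero_iff)
qed

text \<open>The Cauchy product: the absolutely convergent double series over
  \<open>A \<times> B\<close> is regrouped by the total exponent \<open>r = t + u\<close>.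
  Assumption \<open>AB\<close> makes \<open>(t, u)\<close> to \<open>(t + u, t)\<close> a bijection
  onto \<open>R \<times> A\<close>.\<close>

lemma exp_series_mult:
  assumes a: "strip_summable l A a" and b: "strip_summable l B b" and w: "\<bar>Re w\<bar> < l"
    and AB: "\<And>t. t \<in> A \<Longrightarrow> (+) t ` B = R"
    and conv: "\<And>r. r \<in> R \<Longrightarrow> ((\<lambda>t. a t * b (r - t)) has_sum c r) A"
  shows "exp_series A a w * exp_series B b w = exp_series R c w"
proof -
  let ?f = "\<lambda>t. of_real (a t) * exp (of_real t * w)"
  let ?g = "\<lambda>t. of_real (b t) * exp (of_real t * w)"
  have fs: "(?f has_sum exp_series A a w) A" and gs: "(?g has_sum exp_series B b w) B"
    using exp_series_has_sum a b w by blast+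
  obtain N where N: "((\<lambda>u. norm (?g u)) has_sum N) B"
    using exp_series_abs_summable[OF b w] by (auto simp: summable_on_def)
  have abs: "(\<lambda>(t, u). norm (?f t) * norm (?g u)) summable_on (A \<times> B)"
  proof (rule summable_on_SigmaI)
    show "((\<lambda>u. (case (t, u) of (t, u) \<Rightarrow> norm (?f t) * norm (?g u))) has_sum norm (?f t) * N) B" for t
      using has_sum_cmult_right[OF N] by simp
    show "(\<lambda>t. norm (?f t) * N) summable_on A"
      by (intro summable_on_cmult_left exp_series_abs_summable[OF a w])
  qed auto
  have sm: "(\<lambda>(t, u). ?f t * ?g u) summable_on (A \<times> B)"
    by (rule abs_summable_summable) (use abs in \<open>simp only: norm_mult case_prod_unfold\<close>)
  have prod: "((\<lambda>(t, u). ?f t * ?g u) has_sum (exp_series A a w * exp_series B b w)) (A \<times> B)"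
  proof (rule has_sum_SigmaI[OF _ _ sm])
    show "((\<lambda>u. (case (t, u) of (t, u) \<Rightarrow> ?f t * ?g u)) has_sum ?f t * exp_series B b w) B" for t
      using has_sum_cmult_right[OF gs] by simp
    show "((\<lambda>t. ?f t * exp_series B b w) has_sum exp_series A a w * exp_series B b w) A"
      by (rule has_sum_cmult_left[OF fs])
  qed
  have "((\<lambda>(t, u). ?f t * ?g u) has_sum (exp_series A a w * exp_series B b w)) (A \<times> B)
     \<longleftrightarrow> ((\<lambda>(r, t). of_real (a t * b (r - t)) * exp (of_real r * w)) has_sum (exp_series A a w * exp_series B b w)) (R \<times> A)"
  proof (rule has_sum_reindex_bij_witness[where j = "\<lambda>(t, u). (t + u, t)" and i = "\<lambda>(r, t). (t, r - t)"])
    show "(case q of (r, t) \<Rightarrow> (t, r - t)) \<in> A \<times> B" if q: "q \<in> R \<times> A" for q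
    proof -
      obtain r t where "q = (r, t)" "r \<in> R" "t \<in> A" using q by (cases q) auto
      moreover from this obtain u where "u \<in> B" "r = t + u" using AB by blast
      ultimately show ?thesis by simp
    qed
  qed (use AB in \<open>auto simp: exp_add distrib_right\<close>)
  with prod have "((\<lambda>(r, t). of_real (a t * b (r - t)) * exp (of_real r * w)) has_sum (exp_series A a w * exp_series B b w)) (R \<times> A)"
    by simp
  then have "((\<lambda>r. of_real (c r) * exp (of_real r * w)) has_sum (exp_series A a w * exp_series B b w)) R"
  proof (rule has_sum_SigmaD)
    fix r assume "r \<in> R"
    from has_sum_cmult_left[OF has_sum_of_real[OF conv[OF this]]]
    show "((\<lambda>t. (case (r, t) of (r, t) \<Rightarrow> of_real (a t * b (r - t)) * exp (of_real r * w))) has_sum of_real (c r) * exp (of_real r * w)) A"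
      by simp
  qed
  then show ?thesis by (simp add: exp_series_def infsumI)
qed

lemma exp_series_cnj: "exp_series A a (cnj w) = cnj (exp_series A a w)"
proof -
  have "cnj (exp_series A a w) = (\<Sum>\<^sub>\<infinity>t\<in>A. cnj (of_real (a t) * exp (of_real t * w)))"
    by (simp only: exp_series_def infsum_cnj)
  also have "\<dots> = exp_series A a (cnj w)"
    by (simp add: exp_series_def exp_cnj)
  finally show ?thesis by simp
qed

lemma exp_series_uminus:
  assumes "uminus ` A = A"
  shows "exp_series A a (- w) = exp_series A (\<lambda>t. a (- t)) w"
proof -
  have "exp_series A a (- w) = (\<Sum>\<^sub>\<infinity>t\<in>uminus ` A. of_real (a t) * exp (of_real t * (- w)))"
    by (simp add: exp_series_def assms)
  also have "\<dots> = exp_series A (\<lambda>t. a (- t)) w"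
    by (subst infsum_reindex) (auto simp: exp_series_def o_def)
  finally show ?thesis .
qed

lemma exp_series_cmult: "exp_series A (\<lambda>t. c * a t) w = of_real c * exp_series A a w"
  unfolding exp_series_def by (simp add: mult.assoc infsum_cmult_right')

section \<open>Convolution of hyperbolic coefficients\<close>

lemma half_intsE:
  assumes "t \<in> half_ints" obtains n :: int where "t = real_of_int n - 1/2"
  using assms by (auto simp: shifted_ints_def)

lemma half_ints_abs_ge:
  assumes "t \<in> half_ints" shows "1/2 \<le> \<bar>t\<bar>"
proof -
  obtain n :: int where n: "t = real_of_int n - 1/2" using assms by (rule half_intsE)
  show ?thesis
  proof (cases "n \<ge> 1")
    case True
    then have "real_of_int n \<ge> 1" by simp
    then show ?thesis by (simp add: n)
  next
    case False
    then have "real_of_int n \<le> 0" by simp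
    then show ?thesis by (simp add: n)
  qed
qed

lemma uminus_half_ints: "uminus ` half_ints = half_ints"
proof -
  have "- t \<in> half_ints" if t: "t \<in> half_ints" for t
  proof -
    obtain n :: int where "t = real_of_int n - 1/2" using t by (rule half_intsE)
    then have "- t = real_of_int (1 - n) + - (1/2)" by simp
    then show ?thesis unfolding shifted_ints_def by blast
  qed
  then show ?thesis by (force simp: image_iff intro: bexI[of _ "- _"])
qed

lemma uminus_shifted_ints_0: "uminus ` shifted_ints 0 = shifted_ints 0"
proof -
  have "- t \<in> shifted_ints 0" if t: "t \<in> shifted_ints 0" for t
  proof -
    obtain n :: int where "t = real_of_int n" using t by (auto simp: shifted_ints_def)
    then have "- t = real_of_int (- n) + 0" by simp
    then show ?thesis unfolding shifted_ints_def by blast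
  qed
  then show ?thesis by (force simp: image_iff intro: bexI[of _ "- _"])
qed

lemma half_ints_add_shifted_ints_0:
  assumes "t \<in> half_ints" shows "(+) t ` shifted_ints 0 = half_ints"
proof -
  obtain n :: int where n: "t = real_of_int n - 1/2" using assms by (rule half_intsE)
  show ?thesis
  proof (intro equalityI subsetI)
    fix x assume "x \<in> (+) t ` shifted_ints 0"
    then obtain m :: int where "x = real_of_int (n + m) + - (1/2)" by (auto simp: shifted_ints_def n)
    then show "x \<in> half_ints" unfolding shifted_ints_def by blast
  next
    fix x assume "x \<in> half_ints"
    then obtain m :: int where "x = real_of_int m - 1/2" by (rule half_intsE)
    then have "x = t + (real_of_int (m - n) + 0)" by (simp add: n)
    then show "x \<in> (+) t ` shifted_ints 0" unfolding shifted_ints_def by blast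
  qed
qed

lemma half_ints_add_half_ints:
  assumes "t \<in> half_ints" shows "(+) t ` half_ints = shifted_ints 0"
proof -
  obtain n :: int where n: "t = real_of_int n - 1/2" using assms by (rule half_intsE)
  show ?thesis
  proof (intro equalityI subsetI)
    fix x assume "x \<in> (+) t ` half_ints"
    then obtain m :: int where "x = real_of_int (n + m - 1) + 0" by (auto simp: shifted_ints_def n)
    then show "x \<in> shifted_ints 0" unfolding shifted_ints_def by blast
  next
    fix x assume "x \<in> shifted_ints 0"
    then obtain m :: int where "x = t + (real_of_int (m - n + 1) + - (1/2))"
      by (auto simp: n shifted_ints_def)
    then show "x \<in> (+) t ` half_ints" unfolding shifted_ints_def by blast
  qed
qed

lemma half_ints_double: "r \<in> half_ints \<Longrightarrow> 2 * r \<in> \<int>"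
proof -
  assume "r \<in> half_ints"
  then obtain n :: int where "r = real_of_int n - 1/2" by (rule half_intsE)
  then have "2 * r = real_of_int (2 * n - 1)" by simp
  then show ?thesis by (metis Ints_of_int)
qed

lemma shifted_ints_0_double: "r \<in> shifted_ints 0 \<Longrightarrow> 2 * r \<in> \<int>"
  by (auto simp: shifted_ints_def)

lemma int_UNIV_split: "(UNIV :: int set) = range int \<union> range (\<lambda>n. - int n - 1)"
proof (intro equalityI subsetI)
  fix k :: int
  show "k \<in> range int \<union> range (\<lambda>n. - int n - 1)"
  proof (cases "k \<ge> 0")
    case True
    then have "k = int (nat k)" by simp
    then show ?thesis by blast
  next
    case False
    then have "k = - int (nat (- k - 1)) - 1" by simp
    then show ?thesis by blast
  qed
qed auto

lemma has_sum_int_split: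
  fixes f :: "int \<Rightarrow> 'a :: topological_comm_monoid_add"
  assumes "((\<lambda>n. f (int n)) has_sum a) UNIV" "((\<lambda>n. f (- int n - 1)) has_sum b) UNIV"
  shows "(f has_sum (a + b)) UNIV"
proof -
  have "(f has_sum a) (range int)"
    by (subst has_sum_reindex) (use assms in \<open>auto simp: o_def\<close>)
  moreover have "(f has_sum b) (range (\<lambda>n. - int n - 1))"
    by (subst has_sum_reindex) (use assms in \<open>auto simp: o_def inj_on_def\<close>)
  moreover have "range int \<inter> range (\<lambda>n. - int n - 1) = {}" by auto
  ultimately show ?thesis unfolding int_UNIV_split by (rule has_sum_Un_disjoint)
qed

text \<open>Monotonicity makes all increments nonnegative, so the two one-sided telescoping series
  converge unconditionally and can be glued at 0.\<close>

lemma has_sum_int_telescope: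
  fixes f :: "int \<Rightarrow> real"
  assumes mono: "\<And>n. f n \<le> f (n + 1)"
    and P: "(\<lambda>n. f (int n)) \<longlonglongrightarrow> p" and M: "(\<lambda>n. f (- int n)) \<longlonglongrightarrow> m"
  shows "((\<lambda>n. f (n + 1) - f n) has_sum (p - m)) UNIV"
proof -
  have "(\<lambda>n. f (int (Suc n)) - f (int n)) sums (p - f 0)"
    using telescope_sums[OF P] by simp
  then have "((\<lambda>n. f (int n + 1) - f (int n)) has_sum (p - f 0)) UNIV"
    using mono by (intro sums_nonneg_imp_has_sum) (simp_all add: add.commute[of 1])
  moreover have "(\<lambda>n. f (- int n) - f (- int (Suc n))) sums (f 0 - m)"
    using telescope_sums'[OF M] by simp
  then have "((\<lambda>n. f (- int n - 1 + 1) - f (- int n - 1)) has_sum (f 0 - m)) UNIV"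
    using mono[of "- int _ - 1"] by (intro sums_nonneg_imp_has_sum) (simp_all add: minus_diff_commute)
  ultimately have "((\<lambda>n. f (n + 1) - f n) has_sum ((p - f 0) + (f 0 - m))) UNIV"
    by (rule has_sum_int_split)
  then show ?thesis by simp
qed

lemma has_sum_shifted_ints_iff:
  "(f has_sum s) (shifted_ints a) \<longleftrightarrow> ((\<lambda>n::int. f (real_of_int n + a)) has_sum s) UNIV"
  unfolding shifted_ints_def by (subst has_sum_reindex) (auto simp: o_def inj_on_def)

lemma summable_on_exp_abs_shifted_ints:
  fixes e :: real assumes e: "e > 0"
  shows "(\<lambda>t. exp (- e * \<bar>t\<bar>)) summable_on shifted_ints a"
proof -
  have g: "(\<lambda>n::nat. exp (- e) ^ n) sums (1 / (1 - exp (- e)))"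
    using e by (intro geometric_sums) simp
  have e1: "exp (- e) ^ n = exp (- e * real n)" for n
    by (simp add: exp_of_nat_mult[symmetric])
  have g1: "((\<lambda>n::nat. exp (- e * real n)) has_sum (1 / (1 - exp (- e)))) UNIV"
    using g unfolding e1 by (intro sums_nonneg_imp_has_sum) auto
  have g2: "((\<lambda>n::nat. exp (- e) * exp (- e * real n)) has_sum (exp (- e) * (1 / (1 - exp (- e))))) UNIV"
    by (intro has_sum_cmult_right g1)
  have "((\<lambda>n::int. exp (- e * \<bar>real_of_int n\<bar>)) has_sum ((1 / (1 - exp (- e))) + (exp (- e) * (1 / (1 - exp (- e)))))) UNIV"
  proof (rule has_sum_int_split)
    show "((\<lambda>n. exp (- e * \<bar>real_of_int (int n)\<bar>)) has_sum (1 / (1 - exp (- e)))) UNIV"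
      using g1 by simp
    have "exp (- e * \<bar>real_of_int (- int n - 1)\<bar>) = exp (- e) * exp (- e * real n)" for n
    proof -
      have "\<bar>real_of_int (- int n - 1)\<bar> = real n + 1" by simp
      then show ?thesis by (simp add: exp_add[symmetric] algebra_simps)
    qed
    then show "((\<lambda>n. exp (- e * \<bar>real_of_int (- int n - 1)\<bar>)) has_sum (exp (- e) * (1 / (1 - exp (- e))))) UNIV"
      using g2 by simp
  qed
  then have "(\<lambda>n::int. exp (e * \<bar>a\<bar>) * exp (- e * \<bar>real_of_int n\<bar>)) summable_on UNIV"
    by (intro summable_on_cmult_right) (auto simp: summable_on_def)
  then have "(\<lambda>n::int. exp (- e * \<bar>real_of_int n + a\<bar>)) summable_on UNIV"
  proof (rule summable_on_comparison_test)
    fix n :: int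
    have "\<bar>real_of_int n\<bar> \<le> \<bar>real_of_int n + a\<bar> + \<bar>a\<bar>" by linarith
    then have "e * \<bar>real_of_int n\<bar> \<le> e * (\<bar>real_of_int n + a\<bar> + \<bar>a\<bar>)"
      using e by (intro mult_left_mono) auto
    then show "exp (- e * \<bar>real_of_int n + a\<bar>) \<le> exp (e * \<bar>a\<bar>) * exp (- e * \<bar>real_of_int n\<bar>)"
      by (simp add: exp_add[symmetric] distrib_left)
  qed auto
  then show ?thesis
    unfolding summable_on_def has_sum_shifted_ints_iff .
qed

text \<open>The coefficient is at most \<open>2 * exp (- (\<bar>t\<bar> * l))\<close>, which leaves
  geometric decay at rate \<open>l - \<bar>x\<bar>\<close>.\<close>

lemma strip_summable_cosh:
  "strip_summable l (shifted_ints a) (\<lambda>t. 1 / cosh (t * l))"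
  unfolding strip_summable_def
proof (intro allI impI)
  fix x :: real assume x: "\<bar>x\<bar> < l"
  have "(\<lambda>t. 2 * exp (- (l - \<bar>x\<bar>) * \<bar>t\<bar>)) summable_on shifted_ints a"
    using x by (intro summable_on_cmult_right summable_on_exp_abs_shifted_ints) auto
  then show "(\<lambda>t. \<bar>1 / cosh (t * l)\<bar> * exp (t * x)) summable_on shifted_ints a"
  proof (rule summable_on_comparison_test)
    fix t
    have l: "l > 0" using x by linarith
    have "exp \<bar>t * l\<bar> \<le> 2 * cosh (t * l)"
      by (cases "t * l \<ge> 0") (auto simp: cosh_field_def)
    then have "1 / cosh (t * l) \<le> 2 / exp \<bar>t * l\<bar>"
      by (simp add: divide_simps)
    also have "\<dots> = 2 * exp (- (\<bar>t\<bar> * l))" using l by (simp add: exp_minus abs_mult divide_inverse)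
    finally have "\<bar>1 / cosh (t * l)\<bar> * exp (t * x) \<le> 2 * exp (- (\<bar>t\<bar> * l)) * exp (\<bar>t\<bar> * \<bar>x\<bar>)"
      by (intro mult_mono) (auto simp: abs_mult[symmetric])
    also have "\<dots> = 2 * exp (- (l - \<bar>x\<bar>) * \<bar>t\<bar>)"
      by (simp add: exp_add[symmetric] algebra_simps)
    finally show "\<bar>1 / cosh (t * l)\<bar> * exp (t * x) \<le> 2 * exp (- (l - \<bar>x\<bar>) * \<bar>t\<bar>)" .
  qed auto
qed

text \<open>Half-integers stay away from the pole at 0: there
  \<open>\<bar>tanh (t * l)\<bar>\<close> is at least \<open>tanh (l / 2)\<close>, which reduces
  \<open>sinh\<close> to \<open>cosh\<close>.\<close>

lemma strip_summable_sinh: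
  assumes l: "l > 0"
  shows "strip_summable l half_ints (\<lambda>t. 1 / sinh (t * l))"
proof (rule strip_summable_mono[OF strip_summable_cmult[OF strip_summable_cosh, of l "- (1/2)" "1 / tanh (l / 2)"]])
  fix t assume t: "t \<in> half_ints"
  have "l / 2 \<le> \<bar>t * l\<bar>" using half_ints_abs_ge[OF t] l by (simp add: abs_mult)
  then have "tanh (l / 2) \<le> tanh \<bar>t * l\<bar>" by (simp only: tanh_real_le_iff)
  also have "\<dots> = \<bar>sinh (t * l)\<bar> / cosh (t * l)" by (simp add: tanh_def)
  finally have "tanh (l / 2) \<le> \<bar>sinh (t * l)\<bar> / cosh (t * l)" .
  moreover have "tanh (l / 2) > 0" using l by simp
  moreover have "\<bar>sinh (t * l)\<bar> > 0" using half_ints_abs_ge[OF t] l by auto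
  ultimately show "\<bar>1 / sinh (t * l)\<bar> \<le> \<bar>1 / tanh (l / 2) * (1 / cosh (t * l))\<bar>"
    by (simp add: divide_simps abs_mult mult.commute)
qed

text \<open>A shift by one unit telescopes from the limit -1 to the limit 1 and contributes 2; a
  shift by \<open>m\<close> units is \<open>m\<close> such steps.\<close>

lemma tanh_shift_has_sum:
  fixes l c a :: real
  assumes l: "l > 0"
  shows "((\<lambda>t. tanh ((t + c + real m) * l) - tanh ((t + c) * l)) has_sum 2 * real m) (shifted_ints a)"
proof (induction m)
  case (Suc m)
  define f where "f = (\<lambda>n::int. tanh ((real_of_int n + a + c + real m) * l))"
  have "((\<lambda>n. f (n + 1) - f n) has_sum (1 - (- 1))) UNIV"
  proof (rule has_sum_int_telescope)
    show "f n \<le> f (n + 1)" for n using l by (simp add: f_def)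
    have "filterlim (\<lambda>n::nat. l * ((a + c + real m) + real n)) at_top sequentially"
      by (intro filterlim_tendsto_pos_mult_at_top[OF tendsto_const l]
          filterlim_tendsto_add_at_top[OF tendsto_const] filterlim_real_sequentially)
    then show "(\<lambda>n. f (int n)) \<longlonglongrightarrow> 1"
      unfolding f_def by (intro filterlim_compose[OF tanh_real_at_top]) (simp add: algebra_simps)
    have "filterlim (\<lambda>n::nat. l * (- (a + c + real m) + real n)) at_top sequentially"
      by (intro filterlim_tendsto_pos_mult_at_top[OF tendsto_const l]
          filterlim_tendsto_add_at_top[OF tendsto_const] filterlim_real_sequentially)
    then have "filterlim (\<lambda>n::nat. - (l * (- (a + c + real m) + real n))) at_bot sequentially"
      by (simp add: filterlim_uminus_at_bot)
    then show "(\<lambda>n. f (- int n)) \<longlonglongrightarrow> - 1"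
      unfolding f_def by (intro filterlim_compose[OF tanh_real_at_bot]) (simp add: algebra_simps)
  qed
  then have "((\<lambda>t. tanh ((t + c + real (Suc m)) * l) - tanh ((t + c + real m) * l)) has_sum 2) (shifted_ints a)"
    by (simp add: has_sum_shifted_ints_iff f_def algebra_simps)
  from has_sum_add[OF this Suc.IH] show ?case by simp
qed simp

text \<open>The two arguments differ by the integer shift \<open>2 * r\<close>, so the previous
  lemma applies for \<open>r \<ge> 0\<close>; both sides are odd in \<open>r\<close>.\<close>

lemma tanh_symmetric_shift_has_sum:
  fixes l r :: real
  assumes l: "l > 0" and r: "2 * r \<in> \<int>"
  shows "((\<lambda>t. tanh ((t + r) * l) - tanh ((t - r) * l)) has_sum 4 * r) (shifted_ints a)"
proof -
  have *: "((\<lambda>t. tanh ((t + r) * l) - tanh ((t - r) * l)) has_sum 4 * r) (shifted_ints a)"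
    if r: "2 * r \<in> \<int>" "r \<ge> 0" for r
  proof -
    obtain k :: int where k: "2 * r = real_of_int k" using r(1) by (elim Ints_cases)
    then have "k \<ge> 0" using r(2) by linarith
    then have "2 * r = real (nat k)" using k by simp
    then obtain m where "2 * r = real m" by blast
    then have "t + - r + real m = t + r" "2 * real m = 4 * r" for t by auto
    with tanh_shift_has_sum[OF l, of "- r" m a] show ?thesis
      by (simp only: add_uminus_conv_diff)
  qed
  show ?thesis
  proof (cases "r \<ge> 0")
    case True
    then show ?thesis using * r by blast
  next
    case False
    have "2 * (- r) \<in> \<int>" using r by simp
    with False have "((\<lambda>t. - 1 * (tanh ((t + - r) * l) - tanh ((t - - r) * l))) has_sum - 1 * (4 * (- r))) (shifted_ints a)"
      by (intro has_sum_cmult_right *) auto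
    then show ?thesis by simp
  qed
qed

text \<open>The algebra shared by the two convolutions below. There \<open>p\<close> and
  \<open>q\<close> are the values of \<open>cosh\<close> at \<open>b + a\<close> and
  \<open>b - a\<close>, and the sign \<open>e\<close> is -1 when \<open>a\<close> stands for a
  \<open>sinh\<close> and 1 when it stands for a \<open>cosh\<close>.\<close>

lemma partial_fraction_identity:
  fixes a c p q u v e :: real
  assumes "a \<noteq> 0" "c \<noteq> 0" "p \<noteq> 0" "q \<noteq> 0" "c * (p + e * q) = a * (u * q - v * p)"
  shows "1 / a * (1 / q) + e * (1 / a * (1 / p)) = 1 / c * (u / p - v / q)"
proof -
  have "1 / a * (1 / q) + e * (1 / a * (1 / p)) = c * (p + e * q) / (a * c * p * q)"
    using assms(1-4) by (simp add: field_simps)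
  also have "\<dots> = 1 / c * (u / p - v / q)"
    unfolding assms(5) using assms(1-4) by (simp add: field_simps)
  finally show ?thesis .
qed

text \<open>Averaging the summand over \<open>t\<close> and \<open>- t\<close> turns it into a
  multiple of \<open>tanh ((t + r) * l) - tanh ((t - r) * l)\<close>, whose sum is known. The index
  set is symmetric, so this average has the same sum.\<close>

lemma sinh_cosh_convolution:
  assumes l: "l > 0" and r: "2 * r \<in> \<int>"
  shows "((\<lambda>t. 1 / sinh (t * l) * (1 / cosh ((r - t) * l))) has_sum 2 * r * (1 / cosh (r * l))) half_ints"
proof -
  let ?h = "\<lambda>t. 1 / sinh (t * l) * (1 / cosh ((r - t) * l))"
  have "(\<lambda>t. \<bar>1 / sinh (t * l)\<bar>) summable_on half_ints"
    using strip_summable_sinh[OF l, unfolded strip_summable_def, rule_format, of 0] l by simp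
  then have "(\<lambda>t. norm (?h t)) summable_on half_ints"
    by (rule Infinite_Sum.abs_summable_on_comparison_test')
      (auto simp: abs_mult divide_simps mult_le_cancel_left1 cosh_real_ge_1)
  then obtain I where I: "(?h has_sum I) half_ints"
    using abs_summable_summable[of ?h] unfolding summable_on_def by blast
  then have "((?h \<circ> uminus) has_sum I) half_ints"
    by (subst has_sum_reindex[symmetric]) (auto simp: uminus_half_ints)
  from has_sum_add[OF I this]
  have s1: "((\<lambda>t. ?h t + ?h (- t)) has_sum 2 * I) half_ints" by simp
  have s2: "((\<lambda>t. 1 / cosh (r * l) * (tanh ((t + r) * l) - tanh ((t - r) * l))) has_sum 1 / cosh (r * l) * (4 * r)) half_ints"
    by (intro has_sum_cmult_right tanh_symmetric_shift_has_sum l r)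
  have "?h t + ?h (- t) = 1 / cosh (r * l) * (tanh ((t + r) * l) - tanh ((t - r) * l))"
    if t: "t \<in> half_ints" for t
  proof -
    define a b where "a = t * l" and "b = r * l"
    have "sinh a \<noteq> 0" using half_ints_abs_ge[OF t] l by (auto simp: a_def)
    moreover have "cosh (b - a) \<noteq> 0" "cosh (b + a) \<noteq> 0" "cosh b \<noteq> 0" "cosh (a - b) \<noteq> 0"
      by simp_all
    moreover have "cosh b * (cosh (b + a) - cosh (b - a)) = sinh a * (sinh (a + b) * cosh (b - a) - sinh (a - b) * cosh (b + a))"
      unfolding cosh_add cosh_diff sinh_add sinh_diff using hyperbolic_pythagoras[of a] by algebra
    moreover have "cosh (a + b) = cosh (b + a)" "cosh (a - b) = cosh (b - a)"
      by (simp_all add: add.commute cosh_diff mult.commute)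
    ultimately have "1 / sinh a * (1 / cosh (b - a)) - 1 / sinh a * (1 / cosh (b + a))
        = 1 / cosh b * (sinh (a + b) / cosh (a + b) - sinh (a - b) / cosh (a - b))"
      using partial_fraction_identity[of "sinh a" "cosh b" "cosh (b + a)" "cosh (b - a)" "- 1" "sinh (a + b)" "sinh (a - b)"]
      by (simp only:) simp
    then show ?thesis
      by (simp add: a_def b_def tanh_def left_diff_distrib distrib_right)
  qed
  with s1 have "((\<lambda>t. 1 / cosh (r * l) * (tanh ((t + r) * l) - tanh ((t - r) * l))) has_sum 2 * I) half_ints"
    by (subst has_sum_cong[symmetric]) auto
  from has_sum_unique[OF this s2] have "2 * I = 1 / cosh (r * l) * (4 * r)" .
  then have "I = 2 * r * (1 / cosh (r * l))" by simp
  with I show ?thesis by simp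
qed

text \<open>The same symmetrization with \<open>e = 1\<close>. The common factor is now
  \<open>1 / sinh (r * l)\<close>, whence the condition \<open>r \<noteq> 0\<close>.\<close>

lemma cosh_cosh_convolution:
  assumes l: "l > 0" and r: "2 * r \<in> \<int>" "r \<noteq> 0"
  shows "((\<lambda>t. 1 / cosh (t * l) * (1 / cosh ((r - t) * l))) has_sum 2 * r * (1 / sinh (r * l))) half_ints"
proof -
  let ?h = "\<lambda>t. 1 / cosh (t * l) * (1 / cosh ((r - t) * l))"
  have "(\<lambda>t. \<bar>1 / cosh (t * l)\<bar>) summable_on half_ints"
    using strip_summable_cosh[of l, unfolded strip_summable_def, rule_format, of 0] l by simp
  then have "(\<lambda>t. norm (?h t)) summable_on half_ints"
    by (rule Infinite_Sum.abs_summable_on_comparison_test')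
      (auto simp: abs_mult divide_simps mult_le_cancel_left1 cosh_real_ge_1)
  then obtain I where I: "(?h has_sum I) half_ints"
    using abs_summable_summable[of ?h] unfolding summable_on_def by blast
  then have "((?h \<circ> uminus) has_sum I) half_ints"
    by (subst has_sum_reindex[symmetric]) (auto simp: uminus_half_ints)
  from has_sum_add[OF I this]
  have s1: "((\<lambda>t. ?h t + ?h (- t)) has_sum 2 * I) half_ints" by simp
  have s2: "((\<lambda>t. 1 / sinh (r * l) * (tanh ((t + r) * l) - tanh ((t - r) * l))) has_sum 1 / sinh (r * l) * (4 * r)) half_ints"
    by (intro has_sum_cmult_right tanh_symmetric_shift_has_sum l r)
  have "?h t + ?h (- t) = 1 / sinh (r * l) * (tanh ((t + r) * l) - tanh ((t - r) * l))" for t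
  proof -
    define a b where "a = t * l" and "b = r * l"
    have "sinh b \<noteq> 0" using r l by (auto simp: b_def)
    moreover have "cosh (b - a) \<noteq> 0" "cosh (b + a) \<noteq> 0" "cosh a \<noteq> 0" "cosh (a - b) \<noteq> 0"
      by simp_all
    moreover have "sinh b * (cosh (b + a) + cosh (b - a)) = cosh a * (sinh (a + b) * cosh (b - a) - sinh (a - b) * cosh (b + a))"
      unfolding cosh_add cosh_diff sinh_add sinh_diff using hyperbolic_pythagoras[of a] by algebra
    moreover have "cosh (a + b) = cosh (b + a)" "cosh (a - b) = cosh (b - a)"
      by (simp_all add: add.commute cosh_diff mult.commute)
    ultimately have "1 / cosh a * (1 / cosh (b - a)) + 1 / cosh a * (1 / cosh (b + a))
        = 1 / sinh b * (sinh (a + b) / cosh (a + b) - sinh (a - b) / cosh (a - b))"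
      using partial_fraction_identity[of "cosh a" "sinh b" "cosh (b + a)" "cosh (b - a)" 1 "sinh (a + b)" "sinh (a - b)"]
      by (simp only:) simp
    then show ?thesis
      by (simp add: a_def b_def tanh_def left_diff_distrib distrib_right)
  qed
  with s1 have "((\<lambda>t. 1 / sinh (r * l) * (tanh ((t + r) * l) - tanh ((t - r) * l))) has_sum 2 * I) half_ints"
    by (subst has_sum_cong[symmetric]) auto
  from has_sum_unique[OF this s2] have "2 * I = 1 / sinh (r * l) * (4 * r)" .
  then have "I = 2 * r * (1 / sinh (r * l))" by simp
  with I show ?thesis by simp
qed

section \<open>The differential system for the three series\<close>

text \<open>With \<open>C\<close> and \<open>D\<close> the values of \<open>theta_c\<close> and
  \<open>theta_d\<close> at 0, the quotients \<open>theta_c / C\<close>, \<open>theta_s / C\<close>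
  and \<open>theta_d / D\<close> are the Jacobi functions nc, sc and dc at \<open>D * w / 2\<close>,
  with complementary modulus \<open>C / D\<close>.\<close>

definition theta_c :: "real \<Rightarrow> complex \<Rightarrow> complex" where
  "theta_c l = exp_series half_ints (\<lambda>t. 1 / cosh (t * l))"

definition theta_s :: "real \<Rightarrow> complex \<Rightarrow> complex" where
  "theta_s l = exp_series half_ints (\<lambda>t. 1 / sinh (t * l))"

definition theta_d :: "real \<Rightarrow> complex \<Rightarrow> complex" where
  "theta_d l = exp_series (shifted_ints 0) (\<lambda>t. 1 / cosh (t * l))"

text \<open>The convolution produces the coefficients \<open>2 * r / cosh (r * l)\<close>, which
  belong to twice the derivative of \<open>theta_c\<close>. The next two lemmas do the same for
  \<open>theta_s\<close> and \<open>theta_d\<close>.\<close>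

lemma theta_s_mult_theta_d:
  assumes "l > 0" "\<bar>Re w\<bar> < l"
  shows "theta_s l w * theta_d l w = 2 * exp_series half_ints (\<lambda>t. t * (1 / cosh (t * l))) w"
proof -
  have "theta_s l w * theta_d l w = exp_series half_ints (\<lambda>t. 2 * t * (1 / cosh (t * l))) w"
    unfolding theta_s_def theta_d_def
    by (rule exp_series_mult[OF strip_summable_sinh strip_summable_cosh _ half_ints_add_shifted_ints_0])
      (use assms in \<open>auto intro: sinh_cosh_convolution half_ints_double simp del: times_divide_eq_left times_divide_eq_right\<close>)
  then show ?thesis using exp_series_cmult[of half_ints 2] by (simp only: mult.assoc of_real_numeral)
qed

lemma theta_c_mult_theta_d:
  assumes "l > 0" "\<bar>Re w\<bar> < l"
  shows "theta_c l w * theta_d l w = 2 * exp_series half_ints (\<lambda>t. t * (1 / sinh (t * l))) w"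
proof -
  have nz: "r \<noteq> 0" if "r \<in> half_ints" for r using half_ints_abs_ge[OF that] by auto
  have "theta_c l w * theta_d l w = exp_series half_ints (\<lambda>t. 2 * t * (1 / sinh (t * l))) w"
    unfolding theta_c_def theta_d_def
    by (rule exp_series_mult[OF strip_summable_cosh strip_summable_cosh _ half_ints_add_shifted_ints_0])
      (use assms nz in \<open>auto intro: cosh_cosh_convolution half_ints_double simp del: times_divide_eq_left times_divide_eq_right\<close>)
  then show ?thesis using exp_series_cmult[of half_ints 2] by (simp only: mult.assoc of_real_numeral)
qed

lemma theta_s_mult_theta_c:
  assumes "l > 0" "\<bar>Re w\<bar> < l"
  shows "theta_s l w * theta_c l w = 2 * exp_series (shifted_ints 0) (\<lambda>t. t * (1 / cosh (t * l))) w"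
proof -
  have "theta_s l w * theta_c l w = exp_series (shifted_ints 0) (\<lambda>t. 2 * t * (1 / cosh (t * l))) w"
    unfolding theta_s_def theta_c_def
    by (rule exp_series_mult[OF strip_summable_sinh strip_summable_cosh _ half_ints_add_half_ints])
      (use assms in \<open>auto intro: sinh_cosh_convolution shifted_ints_0_double simp del: times_divide_eq_left times_divide_eq_right\<close>)
  then show ?thesis using exp_series_cmult[of "shifted_ints 0" 2] by (simp only: mult.assoc of_real_numeral)
qed

lemma theta_has_field_derivative:
  assumes l: "l > 0" and w: "\<bar>Re w\<bar> < l"
  shows "(theta_c l has_field_derivative theta_s l w * theta_d l w / 2) (at w)"
    and "(theta_s l has_field_derivative theta_c l w * theta_d l w / 2) (at w)"
    and "(theta_d l has_field_derivative theta_s l w * theta_c l w / 2) (at w)"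
  using exp_series_has_field_derivative[OF strip_summable_cosh w, of "- (1/2)"]
    exp_series_has_field_derivative[OF strip_summable_sinh[OF l] w]
    exp_series_has_field_derivative[OF strip_summable_cosh w, of 0]
  unfolding theta_s_mult_theta_d[OF assms] theta_c_mult_theta_d[OF assms] theta_s_mult_theta_c[OF assms]
  by (simp_all add: theta_c_def theta_s_def theta_d_def)

lemma theta_uminus:
  "theta_c l (- w) = theta_c l w" "theta_s l (- w) = - theta_s l w" "theta_d l (- w) = theta_d l w"
  using exp_series_cmult[of half_ints "- 1" "\<lambda>t. 1 / sinh (t * l)" w]
  unfolding theta_c_def theta_s_def theta_d_def
  by (simp_all add: exp_series_uminus uminus_half_ints uminus_shifted_ints_0)

lemma theta_cnj:
  "theta_c l (cnj w) = cnj (theta_c l w)" "theta_s l (cnj w) = cnj (theta_s l w)"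
  "theta_d l (cnj w) = cnj (theta_d l w)"
  unfolding theta_c_def theta_s_def theta_d_def by (rule exp_series_cnj)+

section \<open>Restriction of the series to the real and imaginary axes\<close>

lemma Re_along_real_axis:
  assumes "(f has_field_derivative f') (at (of_real x))"
  shows "((\<lambda>x. Re (f (of_real x))) has_real_derivative Re f') (at x)"
  using has_vector_derivative_real_field[OF assms] by (simp add: has_vector_derivative_complex_iff)

lemma along_imaginary_axis:
  assumes "(f has_field_derivative f') (at (\<i> * of_real y))"
  shows "((\<lambda>y. Re (f (\<i> * of_real y))) has_real_derivative Re (\<i> * f')) (at y)"
    and "((\<lambda>y. Im (f (\<i> * of_real y))) has_real_derivative Im (\<i> * f')) (at y)"
proof -
  have "((\<lambda>z. f (\<i> * z)) has_field_derivative f' * \<i>) (at (of_real y))"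
    by (rule DERIV_chain2[where g = "(*) \<i>" and Da = f', OF assms]) (auto intro!: derivative_eq_intros)
  from has_vector_derivative_real_field[OF this]
  show "((\<lambda>y. Re (f (\<i> * of_real y))) has_real_derivative Re (\<i> * f')) (at y)"
    and "((\<lambda>y. Im (f (\<i> * of_real y))) has_real_derivative Im (\<i> * f')) (at y)"
    by (simp_all add: has_vector_derivative_complex_iff mult.commute)
qed

text \<open>The restrictions of the series to the real and to the imaginary axis, where \<open>theta_s\<close> is purely imaginary.\<close>

definition rtheta_c :: "real \<Rightarrow> real \<Rightarrow> real" where "rtheta_c l x = Re (theta_c l (of_real x))"
definition rtheta_s :: "real \<Rightarrow> real \<Rightarrow> real" where "rtheta_s l x = Re (theta_s l (of_real x))"
definition rtheta_d :: "real \<Rightarrow> real \<Rightarrow> real" where "rtheta_d l x = Re (theta_d l (of_real x))"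

definition itheta_c :: "real \<Rightarrow> real \<Rightarrow> real" where "itheta_c l y = Re (theta_c l (\<i> * of_real y))"
definition itheta_s :: "real \<Rightarrow> real \<Rightarrow> real" where "itheta_s l y = Im (theta_s l (\<i> * of_real y))"
definition itheta_d :: "real \<Rightarrow> real \<Rightarrow> real" where "itheta_d l y = Re (theta_d l (\<i> * of_real y))"

lemma theta_of_real:
  "theta_c l (of_real x) = of_real (rtheta_c l x)" "theta_s l (of_real x) = of_real (rtheta_s l x)"
  "theta_d l (of_real x) = of_real (rtheta_d l x)"
  using theta_cnj[of l "of_real x"] by (simp_all add: rtheta_c_def rtheta_s_def rtheta_d_def complex_eq_iff)

text \<open>On the imaginary axis conjugation is negation, so the even series are real there and the
  odd one is purely imaginary.\<close>

lemma theta_imaginary: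
  "theta_c l (\<i> * of_real y) = of_real (itheta_c l y)" "theta_s l (\<i> * of_real y) = \<i> * of_real (itheta_s l y)"
  "theta_d l (\<i> * of_real y) = of_real (itheta_d l y)"
  using theta_cnj[of l "\<i> * of_real y"] theta_uminus[of l "\<i> * of_real y"]
  by (simp_all add: itheta_c_def itheta_s_def itheta_d_def complex_eq_iff)

lemma theta_real_derivatives:
  assumes "l > 0" "\<bar>x\<bar> < l"
  shows "(rtheta_c l has_real_derivative rtheta_s l x * rtheta_d l x / 2) (at x)"
    and "(rtheta_s l has_real_derivative rtheta_c l x * rtheta_d l x / 2) (at x)"
    and "(rtheta_d l has_real_derivative rtheta_s l x * rtheta_c l x / 2) (at x)"
proof -
  have x: "\<bar>Re (of_real x)\<bar> < l" using assms by simp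
  note d = theta_has_field_derivative[OF assms(1) x, THEN Re_along_real_axis]
  show "(rtheta_c l has_real_derivative rtheta_s l x * rtheta_d l x / 2) (at x)"
    and "(rtheta_s l has_real_derivative rtheta_c l x * rtheta_d l x / 2) (at x)"
    and "(rtheta_d l has_real_derivative rtheta_s l x * rtheta_c l x / 2) (at x)"
    using d by (simp_all add: theta_of_real)
qed

lemma theta_imaginary_derivatives:
  assumes "l > 0"
  shows "(itheta_c l has_real_derivative - (itheta_s l y * itheta_d l y / 2)) (at y)"
    and "(itheta_s l has_real_derivative itheta_c l y * itheta_d l y / 2) (at y)"
    and "(itheta_d l has_real_derivative - (itheta_s l y * itheta_c l y / 2)) (at y)"
proof -
  have y: "\<bar>Re (\<i> * of_real y)\<bar> < l" using assms by simp
  note d = theta_has_field_derivative[OF assms(1) y, THEN along_imaginary_axis(1)]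
     theta_has_field_derivative(2)[OF assms(1) y, THEN along_imaginary_axis(2)]
  show "(itheta_c l has_real_derivative - (itheta_s l y * itheta_d l y / 2)) (at y)"
    and "(itheta_s l has_real_derivative itheta_c l y * itheta_d l y / 2) (at y)"
    and "(itheta_d l has_real_derivative - (itheta_s l y * itheta_c l y / 2)) (at y)"
    using d by (simp_all add: theta_imaginary)
qed

lemma theta_0:
  "rtheta_s l 0 = 0" "itheta_s l 0 = 0" "itheta_c l 0 = rtheta_c l 0" "itheta_d l 0 = rtheta_d l 0"
  using theta_uminus(2)[of l 0] by (simp_all add: rtheta_s_def itheta_s_def itheta_c_def rtheta_c_def itheta_d_def rtheta_d_def)

text \<open>Every term vanishes, because \<open>cos (t * pi) = 0\<close> at half-integers. So
  \<open>pi\<close> will be the end point of the integration along the imaginary axis.\<close>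

lemma itheta_c_pi:
  assumes "l > 0" shows "itheta_c l pi = 0"
proof -
  have "\<bar>Re (\<i> * of_real pi)\<bar> < l" using assms by simp
  from has_sum_Re[OF exp_series_has_sum[OF strip_summable_cosh[of l "- (1/2)"] this]]
  have s: "((\<lambda>t. 1 / cosh (t * l) * cos (t * pi)) has_sum itheta_c l pi) half_ints"
    by (simp add: itheta_c_def theta_c_def Re_exp)
  have "cos (t * pi) = 0" if t: "t \<in> half_ints" for t
  proof -
    obtain n :: int where n: "t = real_of_int n - 1/2" using t by (rule half_intsE)
    have "t * pi = pi * real_of_int n - pi / 2" by (simp add: n algebra_simps)
    then show ?thesis by (simp add: cos_diff sin_int_times_real)
  qed
  then have "((\<lambda>t. 0) has_sum itheta_c l pi) half_ints"
    using s by (subst has_sum_cong[of _ _ "\<lambda>t. 1 / cosh (t * l) * cos (t * pi)"]) auto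
  then show ?thesis using has_sum_unique has_sum_0_simp by blast
qed

section \<open>Positivity, blow-up at the edge of the strip, and first integrals\<close>

lemma theta_real_partial_sums:
  assumes "l > 0" "\<bar>x\<bar> < l"
  shows "finite F \<Longrightarrow> F \<subseteq> half_ints \<Longrightarrow> (\<Sum>t\<in>F. exp (t * x) / cosh (t * l)) \<le> rtheta_c l x"
    and "finite F \<Longrightarrow> F \<subseteq> shifted_ints 0 \<Longrightarrow> (\<Sum>t\<in>F. exp (t * x) / cosh (t * l)) \<le> rtheta_d l x"
proof -
  have x: "\<bar>Re (of_real x)\<bar> < l" using assms by simp
  note s = exp_series_has_sum[OF strip_summable_cosh this, THEN has_sum_Re]
  have c: "((\<lambda>t. exp (t * x) / cosh (t * l)) has_sum rtheta_c l x) half_ints"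
    and d: "((\<lambda>t. exp (t * x) / cosh (t * l)) has_sum rtheta_d l x) (shifted_ints 0)"
    using s[of "- (1/2)"] s[of 0] by (simp_all add: rtheta_c_def rtheta_d_def theta_c_def theta_d_def Re_exp)
  show "finite F \<Longrightarrow> F \<subseteq> half_ints \<Longrightarrow> (\<Sum>t\<in>F. exp (t * x) / cosh (t * l)) \<le> rtheta_c l x"
    by (rule finite_sum_le_has_sum[OF c]) auto
  show "finite F \<Longrightarrow> F \<subseteq> shifted_ints 0 \<Longrightarrow> (\<Sum>t\<in>F. exp (t * x) / cosh (t * l)) \<le> rtheta_d l x"
    by (rule finite_sum_le_has_sum[OF d]) auto
qed

lemma theta_real_pos:
  assumes "l > 0" "\<bar>x\<bar> < l"
  shows "rtheta_c l x > 0" "rtheta_d l x > 0"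
proof -
  have "1/2 \<in> half_ints" unfolding shifted_ints_def by (auto intro!: image_eqI[of _ _ 1])
  then have "exp (1/2 * x) / cosh (1/2 * l) \<le> rtheta_c l x"
    using theta_real_partial_sums(1)[OF assms, of "{1/2}"] by simp
  then show "rtheta_c l x > 0" by (rule less_le_trans[rotated]) simp
  have "0 \<in> shifted_ints 0" unfolding shifted_ints_def by (auto intro!: image_eqI[of _ _ 0])
  then have "exp (0 * x) / cosh (0 * l) \<le> rtheta_d l x"
    using theta_real_partial_sums(2)[OF assms, of "{0}"] by simp
  then show "rtheta_d l x > 0" by (rule less_le_trans[rotated]) simp
qed

text \<open>For \<open>t > 0\<close> a term is at least \<open>exp (t * (x - l))\<close>, which
  tends to 1 as \<open>x\<close> approaches \<open>l\<close>. Hence any \<open>N\<close> positive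
  half-integers push the sum above every \<open>Z < N\<close>.\<close>

lemma rtheta_c_at_left:
  assumes l: "l > 0"
  shows "filterlim (rtheta_c l) at_top (at_left l)"
  unfolding filterlim_at_top
proof
  fix Z :: real
  obtain N :: nat where N: "Z < real N" using reals_Archimedean2 by blast
  define F where "F = (\<lambda>n. real n + 1/2) ` {..<N}"
  have F: "finite F" "F \<subseteq> half_ints" "card F = N" "\<And>t. t \<in> F \<Longrightarrow> t > 0"
  proof -
    show "F \<subseteq> half_ints"
    proof
      fix t assume "t \<in> F"
      then obtain n where "t = real n + 1/2" by (auto simp: F_def)
      then have "t = real_of_int (int n + 1) + - (1/2)" by simp
      then show "t \<in> half_ints" unfolding shifted_ints_def by blast
    qed
    show "card F = N" unfolding F_def by (subst card_image) (auto simp: inj_on_def)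
  qed (auto simp: F_def)
  have "((\<lambda>x. \<Sum>t\<in>F. exp (t * (x - l))) \<longlongrightarrow> (\<Sum>t\<in>F. exp (t * (l - l)))) (at_left l)"
    by (intro tendsto_intros)
  then have "((\<lambda>x. \<Sum>t\<in>F. exp (t * (x - l))) \<longlongrightarrow> real N) (at_left l)"
    using F(3) by simp
  then have "eventually (\<lambda>x. (\<Sum>t\<in>F. exp (t * (x - l))) > Z) (at_left l)"
    using N by (rule order_tendstoD)
  moreover have "eventually (\<lambda>x. x > 0 \<and> x < l) (at_left l)"
    using eventually_at_left_real[OF l] by (rule eventually_mono) auto
  ultimately show "eventually (\<lambda>x. Z \<le> rtheta_c l x) (at_left l)"
  proof eventually_elim
    case (elim x)
    have "(\<Sum>t\<in>F. exp (t * (x - l))) \<le> (\<Sum>t\<in>F. exp (t * x) / cosh (t * l))"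
    proof (rule sum_mono)
      fix t assume "t \<in> F"
      then have "t * l > 0" using F(4) l by simp
      then have "exp (- (t * l)) \<le> exp (t * l)" by simp
      then have "cosh (t * l) \<le> exp (t * l)" by (simp add: cosh_field_def)
      then show "exp (t * (x - l)) \<le> exp (t * x) / cosh (t * l)"
        by (simp add: right_diff_distrib exp_diff frac_le)
    qed
    also have "\<dots> \<le> rtheta_c l x"
      using elim by (intro theta_real_partial_sums(1) l F) auto
    finally show ?case using elim by simp
  qed
qed

lemma DERIV_zero_eq:
  fixes f :: "real \<Rightarrow> real"
  assumes "\<And>x. \<bar>x\<bar> < l \<Longrightarrow> (f has_real_derivative 0) (at x)" "\<bar>x\<bar> < l"
  shows "f x = f 0"
proof -
  have "\<exists>c. \<forall>x\<in>{- l<..<l}. f x = c"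
    by (rule has_field_derivative_zero_constant)
      (auto intro!: has_field_derivative_at_within[OF assms(1)])
  then show ?thesis using assms(2) by (auto simp: abs_less_iff)
qed

text \<open>The differential system makes the differences of squares constant, and
  \<open>rtheta_s\<close> vanishes at 0.\<close>

lemma theta_real_squares:
  assumes l: "l > 0" and x: "\<bar>x\<bar> < l"
  shows "(rtheta_c l x)\<^sup>2 = (rtheta_c l 0)\<^sup>2 + (rtheta_s l x)\<^sup>2" "(rtheta_d l x)\<^sup>2 = (rtheta_d l 0)\<^sup>2 + (rtheta_s l x)\<^sup>2"
proof -
  have "(rtheta_c l x)\<^sup>2 - (rtheta_s l x)\<^sup>2 = (rtheta_c l 0)\<^sup>2 - (rtheta_s l 0)\<^sup>2"
    by (rule DERIV_zero_eq[where l = l, OF _ x])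
      (auto intro!: derivative_eq_intros theta_real_derivatives l)
  then show "(rtheta_c l x)\<^sup>2 = (rtheta_c l 0)\<^sup>2 + (rtheta_s l x)\<^sup>2" by (simp add: theta_0)
  have "(rtheta_d l x)\<^sup>2 - (rtheta_s l x)\<^sup>2 = (rtheta_d l 0)\<^sup>2 - (rtheta_s l 0)\<^sup>2"
    by (rule DERIV_zero_eq[where l = l, OF _ x])
      (auto intro!: derivative_eq_intros theta_real_derivatives l)
  then show "(rtheta_d l x)\<^sup>2 = (rtheta_d l 0)\<^sup>2 + (rtheta_s l x)\<^sup>2" by (simp add: theta_0)
qed

lemma theta_imaginary_square:
  assumes l: "l > 0"
  shows "(itheta_d l y)\<^sup>2 + (itheta_s l y)\<^sup>2 = (rtheta_d l 0)\<^sup>2"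
proof -
  have y: "\<bar>y\<bar> < \<bar>y\<bar> + 1" by simp
  have "(itheta_d l y)\<^sup>2 + (itheta_s l y)\<^sup>2 = (itheta_d l 0)\<^sup>2 + (itheta_s l 0)\<^sup>2"
    by (rule DERIV_zero_eq[OF _ y]) (auto intro!: derivative_eq_intros theta_imaginary_derivatives l)
  then show ?thesis by (simp add: theta_0)
qed

section \<open>Identification of the modulus\<close>

definition theta_am :: "real \<Rightarrow> complex \<Rightarrow> complex" where
  "theta_am l w = w + exp_series (shifted_ints 0) (\<lambda>t. 1 / (t * cosh (t * l))) w"

text \<open>The series in \<open>theta_am\<close> has no constant term, since its coefficient at \<open>t = 0\<close> is \<open>1 / 0 = 0\<close>.\<close>

lemma strip_summable_inverse_cosh: "strip_summable l (shifted_ints 0) (\<lambda>t. 1 / (t * cosh (t * l)))"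
proof (rule strip_summable_mono[OF strip_summable_cosh])
  fix t assume "t \<in> shifted_ints 0"
  then obtain n :: int where n: "t = real_of_int n" by (auto simp: shifted_ints_def)
  show "\<bar>1 / (t * cosh (t * l))\<bar> \<le> \<bar>1 / cosh (t * l)\<bar>"
  proof (cases "n = 0")
    case False
    then have "1 \<le> \<bar>t\<bar>" by (simp add: n)
    then show ?thesis by (simp add: abs_mult divide_simps)
  qed (simp add: n)
qed

lemma theta_am_has_field_derivative:
  assumes w: "\<bar>Re w\<bar> < l"
  shows "(theta_am l has_field_derivative theta_d l w) (at w)"
proof -
  let ?a = "\<lambda>t. 1 / (t * cosh (t * l))"
  have s1: "((\<lambda>t. of_real (t * ?a t) * exp (of_real t * w)) has_sum exp_series (shifted_ints 0) (\<lambda>t. t * ?a t) w) (shifted_ints 0)"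
    by (rule exp_series_has_sum[OF strip_summable_mult[OF strip_summable_inverse_cosh] w])
  have z: "0 \<in> shifted_ints 0" unfolding shifted_ints_def by (auto intro!: image_eqI[of _ _ 0])
  \<comment> \<open>The constant term \<open>1 / cosh 0\<close> of \<open>theta_d\<close>; it comes
    from the derivative of the summand \<open>w\<close> in \<open>theta_am\<close>.\<close>
  have s2: "((\<lambda>t. if t = 0 then 1 else 0) has_sum (1 :: complex)) (shifted_ints 0)"
    by (rule has_sum_finite_neutralI[of "{0}"]) (use z in auto)
  have eq: "(if t = 0 then 1 else 0) + of_real (t * ?a t) * exp (of_real t * w)
      = of_real (1 / cosh (t * l)) * exp (of_real t * w)" for t
    by simp
  have "theta_d l w = 1 + exp_series (shifted_ints 0) (\<lambda>t. t * ?a t) w"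
    using has_sum_add[OF s2 s1] unfolding eq theta_d_def exp_series_def by (rule infsumI)
  moreover have "(theta_am l has_field_derivative 1 + exp_series (shifted_ints 0) (\<lambda>t. t * ?a t) w) (at w)"
    unfolding theta_am_def
    by (intro DERIV_add DERIV_ident exp_series_has_field_derivative[where l = l] strip_summable_inverse_cosh w)
  ultimately show ?thesis by simp
qed

text \<open>The Jacobi amplitude for modulus \<open>C / D\<close> at \<open>D * y / 2\<close>, with
  \<open>C\<close> and \<open>D\<close> the values of \<open>rtheta_c l\<close> and
  \<open>rtheta_d l\<close> at 0. Its explicit series gives its values at multiples of
  \<open>pi\<close>.\<close>

definition itheta_am :: "real \<Rightarrow> real \<Rightarrow> real" where "itheta_am l y = Im (theta_am l (\<i> * of_real y)) / 2"

lemma itheta_am_has_real_derivative: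
  assumes "l > 0"
  shows "(itheta_am l has_real_derivative itheta_d l y / 2) (at y)"
proof -
  have "\<bar>Re (\<i> * of_real y)\<bar> < l" using assms by simp
  note theta_am_has_field_derivative[OF this, THEN along_imaginary_axis(2)]
  from DERIV_cdivide[OF this, of 2] show ?thesis by (simp add: itheta_am_def[abs_def] itheta_d_def)
qed

text \<open>All sine terms vanish at integer multiples of \<open>pi\<close>, so only the linear term
  remains.\<close>

lemma itheta_am_int_pi:
  assumes "l > 0" shows "itheta_am l (real_of_int k * pi) = real_of_int k * pi / 2"
proof -
  have "\<bar>Re (\<i> * of_real (real_of_int k * pi))\<bar> < l" using assms by simp
  from has_sum_Im[OF exp_series_has_sum[OF strip_summable_inverse_cosh[of l] this]]
  have s: "((\<lambda>t. sin (t * (real_of_int k * pi)) / (t * cosh (t * l))) has_sum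
      Im (exp_series (shifted_ints 0) (\<lambda>t. 1 / (t * cosh (t * l))) (\<i> * of_real (real_of_int k * pi)))) (shifted_ints 0)"
    by (simp add: Im_exp)
  have "sin (t * (real_of_int k * pi)) = 0" if t: "t \<in> shifted_ints 0" for t
  proof -
    obtain n :: int where "t = real_of_int n" using t by (auto simp: shifted_ints_def)
    then have "t * (real_of_int k * pi) = pi * real_of_int (n * k)" by simp
    then show ?thesis by (simp only: sin_zero_iff_int2) (metis mult.commute)
  qed
  then have "((\<lambda>t. 0) has_sum
      Im (exp_series (shifted_ints 0) (\<lambda>t. 1 / (t * cosh (t * l))) (\<i> * of_real (real_of_int k * pi)))) (shifted_ints 0)"
    using s by (subst has_sum_cong[of _ _ "\<lambda>t. sin (t * (real_of_int k * pi)) / (t * cosh (t * l))"]) auto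
  then have "Im (exp_series (shifted_ints 0) (\<lambda>t. 1 / (t * cosh (t * l))) (\<i> * of_real (real_of_int k * pi))) = 0"
    using has_sum_unique has_sum_0_simp by blast
  then show ?thesis by (simp add: itheta_am_def theta_am_def)
qed

text \<open>The vector (\<open>itheta_c\<close>, \<open>itheta_s\<close>) rotates with angular speed
  \<open>itheta_d / 2\<close>, the derivative of \<open>itheta_am\<close>. Rotated back by that
  angle it is constant, and these two constants are the components computed first.\<close>

lemma itheta_s_amplitude:
  assumes l: "l > 0"
  shows "itheta_s l y = rtheta_c l 0 * sin (itheta_am l y)"
proof -
  have y: "\<bar>y\<bar> < \<bar>y\<bar> + 1" by simp
  have u0: "itheta_am l 0 = 0" using itheta_am_int_pi[OF l, of 0] by simp
  have "itheta_c l y * cos (itheta_am l y) + itheta_s l y * sin (itheta_am l y) = itheta_c l 0 * cos (itheta_am l 0) + itheta_s l 0 * sin (itheta_am l 0)"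
    by (rule DERIV_zero_eq[OF _ y])
      (auto intro!: derivative_eq_intros theta_imaginary_derivatives itheta_am_has_real_derivative l simp: algebra_simps)
  then have 1: "itheta_c l y * cos (itheta_am l y) + itheta_s l y * sin (itheta_am l y) = rtheta_c l 0" by (simp add: theta_0 u0)
  have "itheta_s l y * cos (itheta_am l y) - itheta_c l y * sin (itheta_am l y) = itheta_s l 0 * cos (itheta_am l 0) - itheta_c l 0 * sin (itheta_am l 0)"
    by (rule DERIV_zero_eq[OF _ y])
      (auto intro!: derivative_eq_intros theta_imaginary_derivatives itheta_am_has_real_derivative l simp: algebra_simps)
  then have 2: "itheta_s l y * cos (itheta_am l y) - itheta_c l y * sin (itheta_am l y) = 0" by (simp add: theta_0 u0)
  have "itheta_s l y = itheta_s l y * ((sin (itheta_am l y))\<^sup>2 + (cos (itheta_am l y))\<^sup>2)" by simp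
  also have "\<dots> = (itheta_c l y * cos (itheta_am l y) + itheta_s l y * sin (itheta_am l y)) * sin (itheta_am l y)
      + (itheta_s l y * cos (itheta_am l y) - itheta_c l y * sin (itheta_am l y)) * cos (itheta_am l y)"
    by algebra
  also have "\<dots> = rtheta_c l 0 * sin (itheta_am l y)" unfolding 1 2 by simp
  finally show ?thesis .
qed

text \<open>With the integrating factor \<open>exp (- G y)\<close> the solution becomes constant, so
  it cannot change sign.\<close>

lemma linear_ode_pos:
  fixes a g :: "real \<Rightarrow> real"
  assumes g: "\<And>y. (g has_real_derivative a y * g y) (at y)" and a: "\<And>y. isCont a y"
    and pos: "g y0 > 0"
  shows "g y > 0"
proof -
  define p q where "p = min y y0 - 1" and "q = max y y0 + 1"
  define G where "G = (\<lambda>y. integral {p..y} a)"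
  have G: "(G has_real_derivative a y) (at y within {p..q})" if y: "y \<in> {p..q}" for y
    unfolding G_def by (rule integral_has_real_derivative[OF _ y]) (auto intro!: continuous_at_imp_continuous_on a)
  have "\<exists>c. \<forall>y\<in>{p..q}. g y * exp (- G y) = c"
  proof (rule has_field_derivative_zero_constant)
    fix y assume y: "y \<in> {p..q}"
    show "((\<lambda>y. g y * exp (- G y)) has_real_derivative 0) (at y within {p..q})"
      by (auto intro!: derivative_eq_intros G[OF y] has_field_derivative_at_within[OF g])
  qed simp
  moreover have "y \<in> {p..q}" "y0 \<in> {p..q}" by (auto simp: p_def q_def)
  ultimately have "g y * exp (- G y) = g y0 * exp (- G y0)" by metis
  also have "\<dots> > 0" using pos by simp
  finally show ?thesis by (simp add: zero_less_mult_iff)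
qed

text \<open>Sum and difference of \<open>itheta_d\<close> and \<open>itheta_c\<close> each solve a
  homogeneous linear equation. The sum is positive at 0. At \<open>pi\<close> the two coincide
  because \<open>itheta_c\<close> vanishes, so positivity passes to the difference and back along
  the whole axis.\<close>

lemma itheta_c_less_itheta_d:
  assumes l: "l > 0"
  shows "\<bar>itheta_c l y\<bar> < itheta_d l y"
proof -
  have cont: "isCont (itheta_s l) y" for y
    using theta_imaginary_derivatives(2)[OF l] by (rule DERIV_isCont)
  have plus: "itheta_d l y + itheta_c l y > 0" for y
  proof (rule linear_ode_pos[where a = "\<lambda>y. - itheta_s l y / 2" and ?y0.0 = 0 and g = "\<lambda>y. itheta_d l y + itheta_c l y"])
    show "itheta_d l 0 + itheta_c l 0 > 0" using theta_real_pos[OF l, of 0] l by (simp add: theta_0)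
  qed (auto intro!: derivative_eq_intros theta_imaginary_derivatives l cont continuous_intros simp: algebra_simps)
  have minus: "itheta_d l y - itheta_c l y > 0" for y
  proof (rule linear_ode_pos[where a = "\<lambda>y. itheta_s l y / 2" and ?y0.0 = pi and g = "\<lambda>y. itheta_d l y - itheta_c l y"])
    show "itheta_d l pi - itheta_c l pi > 0" using plus[of pi] by (simp add: itheta_c_pi l)
  qed (auto intro!: derivative_eq_intros theta_imaginary_derivatives l cont continuous_intros simp: algebra_simps)
  show ?thesis using plus[of y] minus[of y] by (auto simp: abs_less_iff)
qed

lemma rtheta_c_less_rtheta_d: "l > 0 \<Longrightarrow> rtheta_c l 0 < rtheta_d l 0"
  using itheta_c_less_itheta_d[of l 0] theta_real_pos(1)[of l 0] by (simp add: theta_0)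

text \<open>Integrating from \<open>- pi\<close> makes \<open>ellF k\<close> differentiable at \<open>0\<close>, as integrals over \<open>{0..x}\<close> vanish for \<open>x < 0\<close>.\<close>

definition ellF :: "real \<Rightarrow> real \<Rightarrow> real" where
  "ellF k \<phi> = integral {- pi..\<phi>} (\<lambda>\<theta>. 1 / sqrt (1 - k^2 * (sin \<theta>)^2))
            - integral {- pi..0} (\<lambda>\<theta>. 1 / sqrt (1 - k^2 * (sin \<theta>)^2))"

section \<open>Incomplete and complete elliptic integrals of the first kind\<close>

lemma ellK_radicand_pos:
  assumes "(k::real)\<^sup>2 < 1" shows "0 < 1 - k\<^sup>2 * (sin \<theta>)\<^sup>2"
proof -
  have "k\<^sup>2 * (sin \<theta>)\<^sup>2 \<le> k\<^sup>2 * 1" by (intro mult_left_mono) (auto simp: abs_square_le_1)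
  then show ?thesis using assms by simp
qed

lemma ellK_integrand_continuous:
  assumes "(k::real)\<^sup>2 < 1" shows "continuous_on A (\<lambda>\<theta>. 1 / sqrt (1 - k^2 * (sin \<theta>)^2))"
proof (intro continuous_intros)
  show "\<forall>\<theta>\<in>A. sqrt (1 - k\<^sup>2 * (sin \<theta>)\<^sup>2) \<noteq> 0"
    using ellK_radicand_pos[OF assms] by (metis less_irrefl real_sqrt_eq_zero_cancel_iff)
qed

lemma ellF_has_real_derivative:
  assumes k: "k\<^sup>2 < 1" and "- pi < \<phi>" "\<phi> < pi"
  shows "(ellF k has_real_derivative 1 / sqrt (1 - k^2 * (sin \<phi>)^2)) (at \<phi>)"
proof -
  have "((\<lambda>\<phi>. integral {- pi..\<phi>} (\<lambda>\<theta>. 1 / sqrt (1 - k^2 * (sin \<theta>)^2))) has_real_derivative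
      1 / sqrt (1 - k^2 * (sin \<phi>)^2)) (at \<phi> within {- pi..pi})"
    by (rule integral_has_real_derivative) (use assms in \<open>auto intro!: ellK_integrand_continuous\<close>)
  moreover have "at \<phi> within {- pi..pi} = at \<phi>"
    by (rule at_within_interior) (use assms in auto)
  ultimately show ?thesis
    unfolding ellF_def by (auto intro!: derivative_eq_intros)
qed

lemma ellF_0: "ellF k 0 = 0"
  by (simp add: ellF_def)

lemma ellF_pi_half:
  assumes k: "k\<^sup>2 < 1" shows "ellF k (pi / 2) = ellK k"
proof -
  have "integral {- pi..0} (\<lambda>\<theta>. 1 / sqrt (1 - k^2 * (sin \<theta>)^2)) + integral {0..pi/2} (\<lambda>\<theta>. 1 / sqrt (1 - k^2 * (sin \<theta>)^2))
     = integral {- pi..pi/2} (\<lambda>\<theta>. 1 / sqrt (1 - k^2 * (sin \<theta>)^2))"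
    by (rule Henstock_Kurzweil_Integration.integral_combine)
      (auto intro!: integrable_continuous_interval ellK_integrand_continuous k)
  then show ?thesis by (simp add: ellF_def ellK_def)
qed

lemma ellF_strict_mono:
  assumes k: "k\<^sup>2 < 1" and "- pi < a" "a < b" "b < pi"
  shows "ellF k a < ellF k b"
proof (rule DERIV_pos_imp_increasing[OF \<open>a < b\<close>])
  fix x assume "a \<le> x" "x \<le> b"
  then show "\<exists>y. (ellF k has_real_derivative y) (at x) \<and> y > 0"
    using assms ellK_radicand_pos[OF k] by (intro exI[of _ "1 / sqrt (1 - k^2 * (sin x)^2)"] conjI ellF_has_real_derivative) auto
qed

lemma ellF_inj:
  assumes "k\<^sup>2 < 1" "ellF k a = ellF k b" "- pi < a" "- pi < b" "a < pi" "b < pi"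
  shows "a = b"
  using ellF_strict_mono[OF assms(1), of a b] ellF_strict_mono[OF assms(1), of b a] assms
  by (cases a b rule: linorder_cases) auto

lemma ellK_pos: "k\<^sup>2 < 1 \<Longrightarrow> ellK k > 0"
  using ellF_strict_mono[of k 0 "pi/2"] pi_gt_zero unfolding ellF_pi_half[symmetric]
  by (simp add: ellF_0)

lemma ellK_strict_mono:
  assumes "0 \<le> k" "k < k'" "k' < 1"
  shows "ellK k < ellK k'"
proof -
  have sq: "k\<^sup>2 < k'\<^sup>2" using assms by (intro power_strict_mono) auto
  have k': "k'\<^sup>2 < 1" using assms by (simp add: power_less_one_iff)
  have k: "k\<^sup>2 < 1" using sq k' by simp
  have "ellF k' 0 - ellF k 0 < ellF k' (pi/2) - ellF k (pi/2)"
  \<comment> \<open>The two integrands agree at angle 0, so the derivative of the difference is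
    positive only in the open interval.\<close>
  proof (rule DERIV_pos_imp_increasing_open[of 0 "pi/2" "\<lambda>x. ellF k' x - ellF k x"])
    fix x :: real assume x: "0 < x" "x < pi / 2"
    have "sin x > 0" using x by (intro sin_gt_zero) auto
    then have "k\<^sup>2 * (sin x)\<^sup>2 < k'\<^sup>2 * (sin x)\<^sup>2" using sq by simp
    then have "1 / sqrt (1 - k^2 * (sin x)^2) < 1 / sqrt (1 - k'^2 * (sin x)^2)"
      using ellK_radicand_pos[OF k', of x] by (intro divide_strict_left_mono) auto
    then show "\<exists>y. ((\<lambda>x. ellF k' x - ellF k x) has_real_derivative y) (at x) \<and> 0 < y"
      using x by (intro exI[of _ "1 / sqrt (1 - k'^2 * (sin x)^2) - 1 / sqrt (1 - k^2 * (sin x)^2)"] conjI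
          DERIV_diff ellF_has_real_derivative k k') auto
  next
    show "continuous_on {0..pi/2} (\<lambda>x. ellF k' x - ellF k x)"
    proof (intro continuous_at_imp_continuous_on ballI)
      fix x assume "x \<in> {0..pi/2}"
      then have x: "- pi < x" "x < pi" using pi_gt_zero by (auto simp del: pi_gt_zero)
      show "isCont (\<lambda>x. ellF k' x - ellF k x) x"
        by (rule DERIV_isCont[OF DERIV_diff[OF ellF_has_real_derivative ellF_has_real_derivative]])
          (use x k k' pi_gt_zero in auto)
    qed
  qed simp
  then show ?thesis by (simp add: ellF_0 ellF_pi_half k k')
qed

lemma rtheta_s_nonneg:
  assumes l: "l > 0" and x: "0 \<le> x" "x < l"
  shows "0 \<le> rtheta_s l x"
proof -
  have "rtheta_s l 0 \<le> rtheta_s l x"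
  proof (rule DERIV_nonneg_imp_nondecreasing[OF x(1)])
    fix y assume "0 \<le> y" "y \<le> x"
    then have y: "\<bar>y\<bar> < l" using x by auto
    show "\<exists>d. (rtheta_s l has_real_derivative d) (at y) \<and> d \<ge> 0"
      using theta_real_derivatives(2)[OF l y] theta_real_pos[OF l y]
      by (intro exI[of _ "rtheta_c l y * rtheta_d l y / 2"]) auto
  qed
  then show ?thesis by (simp add: theta_0)
qed

lemma arctan_bounds_pi: "- pi < arctan x" "arctan x < pi"
  using arctan_lbound[of x] arctan_ubound[of x] pi_gt_zero by linarith+

section \<open>Periods and midpoint value for the modulus belonging to \<open>l\<close>\<close>

context
  fixes l k C D :: real
  assumes l: "l > 0"
  defines "C \<equiv> rtheta_c l 0" and "D \<equiv> rtheta_d l 0"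
  defines "k \<equiv> sqrt (1 - (C / D)\<^sup>2)"
begin

lemma theta_null_bounds: "0 < C" "C < D" "0 < D"
  using theta_real_pos[OF l, of 0] rtheta_c_less_rtheta_d[OF l] l by (simp_all add: C_def D_def)

lemma modulus_square: "k\<^sup>2 = 1 - (C / D)\<^sup>2" "k\<^sup>2 < 1"
proof -
  have "(C / D)\<^sup>2 < 1" using theta_null_bounds by (simp add: power_less_one_iff)
  then show "k\<^sup>2 = 1 - (C / D)\<^sup>2" by (simp add: k_def)
  then show "k\<^sup>2 < 1" using theta_null_bounds by simp
qed

text \<open>Since sc is the tangent of the amplitude, the arctangent is the amplitude and its
  elliptic integral is linear in \<open>x\<close>. The first integrals turn the radical into
  \<open>C * d / (D * c)\<close>, which leaves the constant derivative \<open>D / 2\<close>.\<close>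

lemma ellF_arctan_rtheta_c:
  assumes x: "\<bar>x\<bar> < l"
  shows "ellF k (arctan (rtheta_s l x / C)) = D * x / 2"
proof -
  have "ellF k (arctan (rtheta_s l x / C)) - D * x / 2 = ellF k (arctan (rtheta_s l 0 / C)) - D * 0 / 2"
  proof (rule DERIV_zero_eq[OF _ x])
    fix x assume x: "\<bar>x\<bar> < l"
    let ?c = "rtheta_c l x" and ?s = "rtheta_s l x" and ?d = "rtheta_d l x"
    have pos: "?c > 0" "?d > 0" by (rule theta_real_pos[OF l x])+
    have sq: "?c\<^sup>2 = C\<^sup>2 + ?s\<^sup>2" "?d\<^sup>2 = D\<^sup>2 + ?s\<^sup>2"
      unfolding C_def D_def by (rule theta_real_squares[OF l x])+
    have e: "1 + (?s / C)\<^sup>2 = (?c / C)\<^sup>2"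
      unfolding power_divide sq using theta_null_bounds by (simp add: field_simps)
    then have inv: "inverse (1 + (?s / C)\<^sup>2) = (C / ?c)\<^sup>2" by (simp add: power_divide)
    have "(sin (arctan (?s / C)))\<^sup>2 = (?s / ?c)\<^sup>2"
      unfolding sin_arctan e real_sqrt_abs using theta_null_bounds pos by simp
    then have "1 - k\<^sup>2 * (sin (arctan (?s / C)))\<^sup>2 = (?c\<^sup>2 - ?s\<^sup>2 + C\<^sup>2 / D\<^sup>2 * ?s\<^sup>2) / ?c\<^sup>2"
      unfolding modulus_square using pos by (simp add: field_simps power_divide)
    also have "?c\<^sup>2 - ?s\<^sup>2 + C\<^sup>2 / D\<^sup>2 * ?s\<^sup>2 = (C * ?d / D)\<^sup>2"
      unfolding power_divide power_mult_distrib sq using theta_null_bounds by (simp add: field_simps)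
    finally have "1 - k\<^sup>2 * (sin (arctan (?s / C)))\<^sup>2 = (C * ?d / (D * ?c))\<^sup>2"
      by (simp add: power_divide power_mult_distrib)
    then have rt: "sqrt (1 - k\<^sup>2 * (sin (arctan (?s / C)))\<^sup>2) = C * ?d / (D * ?c)"
      using theta_null_bounds pos by simp
    have "((\<lambda>x. ellF k (arctan (rtheta_s l x / C))) has_real_derivative
       1 / sqrt (1 - k\<^sup>2 * (sin (arctan (?s / C)))\<^sup>2) * (inverse (1 + (?s / C)\<^sup>2) * (?c * ?d / 2 / C))) (at x)"
      by (rule DERIV_chain2[OF ellF_has_real_derivative[OF modulus_square(2) arctan_bounds_pi]
            DERIV_chain2[OF DERIV_arctan DERIV_cdivide[OF theta_real_derivatives(2)[OF l x]]]])
    also have "1 / sqrt (1 - k\<^sup>2 * (sin (arctan (?s / C)))\<^sup>2) * (inverse (1 + (?s / C)\<^sup>2) * (?c * ?d / 2 / C)) = D / 2"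
      unfolding rt inv using theta_null_bounds pos by (simp add: field_simps power2_eq_square)
    finally show "((\<lambda>x. ellF k (arctan (rtheta_s l x / C)) - D * x / 2) has_real_derivative 0) (at x)"
      by (auto intro!: derivative_eq_intros)
  qed
  then show ?thesis by (simp add: theta_0 ellF_0)
qed

text \<open>Together with the preceding lemma this is the reflection \<open>w \<mapsto> l - w\<close>, which locates the midpoint \<open>l / 2\<close>.\<close>

lemma ellF_arctan_rtheta_d:
  assumes x: "\<bar>x\<bar> < l"
  shows "ellF k (pi / 2 - arctan (rtheta_s l x / D)) = ellK k - D * x / 2"
proof -
  have "ellF k (pi / 2 - arctan (rtheta_s l x / D)) + D * x / 2 = ellF k (pi / 2 - arctan (rtheta_s l 0 / D)) + D * 0 / 2"
  proof (rule DERIV_zero_eq[OF _ x])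
    fix x assume x: "\<bar>x\<bar> < l"
    let ?c = "rtheta_c l x" and ?s = "rtheta_s l x" and ?d = "rtheta_d l x"
    have pos: "?c > 0" "?d > 0" by (rule theta_real_pos[OF l x])+
    have sq: "?c\<^sup>2 = C\<^sup>2 + ?s\<^sup>2" "?d\<^sup>2 = D\<^sup>2 + ?s\<^sup>2"
      unfolding C_def D_def by (rule theta_real_squares[OF l x])+
    have e: "1 + (?s / D)\<^sup>2 = (?d / D)\<^sup>2"
      unfolding power_divide sq using theta_null_bounds by (simp add: field_simps)
    then have inv: "inverse (1 + (?s / D)\<^sup>2) = (D / ?d)\<^sup>2" by (simp add: power_divide)
    have sd: "sin (pi / 2 - arctan (?s / D)) = D / ?d"
      unfolding sin_diff cos_arctan e real_sqrt_abs using theta_null_bounds pos by simp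
    have "1 - k\<^sup>2 * (sin (pi / 2 - arctan (?s / D)))\<^sup>2 = (?d\<^sup>2 - D\<^sup>2 + C\<^sup>2) / ?d\<^sup>2"
      unfolding sd modulus_square using pos theta_null_bounds by (simp add: field_simps power_divide)
    also have "?d\<^sup>2 - D\<^sup>2 + C\<^sup>2 = ?c\<^sup>2" using sq by simp
    finally have "1 - k\<^sup>2 * (sin (pi / 2 - arctan (?s / D)))\<^sup>2 = (?c / ?d)\<^sup>2"
      by (simp add: power_divide)
    then have rt: "sqrt (1 - k\<^sup>2 * (sin (pi / 2 - arctan (?s / D)))\<^sup>2) = ?c / ?d"
      using pos by simp
    have bnd: "- pi < pi / 2 - arctan (?s / D)" "pi / 2 - arctan (?s / D) < pi"
      using arctan_lbound[of "?s / D"] arctan_ubound[of "?s / D"] pi_gt_zero by linarith+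
    have "((\<lambda>x. ellF k (pi / 2 - arctan (rtheta_s l x / D))) has_real_derivative
       1 / sqrt (1 - k\<^sup>2 * (sin (pi / 2 - arctan (?s / D)))\<^sup>2) * (0 - inverse (1 + (?s / D)\<^sup>2) * (?c * ?d / 2 / D))) (at x)"
      by (rule DERIV_chain2[OF ellF_has_real_derivative[OF modulus_square(2) bnd]
            DERIV_diff[OF DERIV_const DERIV_chain2[OF DERIV_arctan DERIV_cdivide[OF theta_real_derivatives(2)[OF l x]]]]])
    also have "1 / sqrt (1 - k\<^sup>2 * (sin (pi / 2 - arctan (?s / D)))\<^sup>2) * (0 - inverse (1 + (?s / D)\<^sup>2) * (?c * ?d / 2 / D)) = - (D / 2)"
      unfolding rt inv using theta_null_bounds pos by (simp add: field_simps power2_eq_square)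
    finally show "((\<lambda>x. ellF k (pi / 2 - arctan (rtheta_s l x / D)) + D * x / 2) has_real_derivative 0) (at x)"
      by (auto intro!: derivative_eq_intros)
  qed
  then show ?thesis by (simp add: theta_0 ellF_pi_half modulus_square(2))
qed

text \<open>Let \<open>x\<close> tend to \<open>l\<close> in \<open>ellF_arctan_rtheta_c\<close>:
  \<open>rtheta_s\<close> tends to infinity, so the amplitude tends to
  \<open>pi / 2\<close>.\<close>

lemma ellK_real_period: "ellK k = D * l / 2"
proof -
  have "filterlim (\<lambda>x. - C + rtheta_c l x) at_top (at_left l)"
    by (rule filterlim_tendsto_add_at_top[OF tendsto_const rtheta_c_at_left[OF l]])
  moreover have "eventually (\<lambda>x. 0 < x \<and> x < l) (at_left l)"
    using eventually_at_left_real[OF l] by (rule eventually_mono) auto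
  \<comment> \<open>\<open>rtheta_c\<close> is the square root of
    \<open>C\<^sup>2 + (rtheta_s l x)\<^sup>2\<close>, hence at most
    \<open>C + rtheta_s l x\<close>; this transfers the blow-up to \<open>rtheta_s\<close>.\<close>
  then have "eventually (\<lambda>x. - C + rtheta_c l x \<le> rtheta_s l x) (at_left l)"
  proof eventually_elim
    case (elim x)
    then have x: "\<bar>x\<bar> < l" by auto
    have s: "rtheta_s l x \<ge> 0" using elim l by (intro rtheta_s_nonneg) auto
    have "(rtheta_c l x)\<^sup>2 = C\<^sup>2 + (rtheta_s l x)\<^sup>2" unfolding C_def by (rule theta_real_squares[OF l x])
    also have "\<dots> \<le> (C + rtheta_s l x)\<^sup>2" using s theta_null_bounds by (simp add: power2_sum)
    finally have "rtheta_c l x \<le> C + rtheta_s l x" using s theta_null_bounds by (intro power2_le_imp_le[of "rtheta_c l x"]) auto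
    then show ?case by simp
  qed
  ultimately have "filterlim (rtheta_s l) at_top (at_left l)" by (rule filterlim_at_top_mono)
  then have "filterlim (\<lambda>x. inverse C * rtheta_s l x) at_top (at_left l)"
    using theta_null_bounds by (intro filterlim_tendsto_pos_mult_at_top[OF tendsto_const]) auto
  then have at: "((\<lambda>x. arctan (rtheta_s l x / C)) \<longlongrightarrow> pi / 2) (at_left l)"
    by (intro filterlim_compose[OF tendsto_arctan_at_top]) (simp add: divide_inverse mult.commute)
  have "isCont (ellF k) (pi / 2)"
    by (rule DERIV_isCont[OF ellF_has_real_derivative[OF modulus_square(2)]]) auto
  from isCont_tendsto_compose[OF this at] have 1: "((\<lambda>x. ellF k (arctan (rtheta_s l x / C))) \<longlongrightarrow> ellF k (pi / 2)) (at_left l)"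
    .
  have 2: "((\<lambda>x. D * x / 2) \<longlongrightarrow> D * l / 2) (at_left l)"
    by (intro tendsto_intros) auto
  have "eventually (\<lambda>x. ellF k (arctan (rtheta_s l x / C)) = D * x / 2) (at_left l)"
    using eventually_at_left_real[OF l]
    by (rule eventually_mono) (rule ellF_arctan_rtheta_c, auto)
  from tendsto_cong[OF this] 1 have "((\<lambda>x. D * x / 2) \<longlongrightarrow> ellF k (pi / 2)) (at_left l)" by simp
  from tendsto_unique[OF _ this 2] show ?thesis by (simp add: ellF_pi_half modulus_square(2))
qed

text \<open>As \<open>y\<close> runs from 0 to \<open>pi\<close> the amplitude runs from 0 to
  \<open>pi / 2\<close>. The radical equals \<open>itheta_d / D\<close> and cancels against the
  derivative \<open>itheta_d / 2\<close> of the amplitude, so the elliptic integral grows at the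
  constant rate \<open>D / 2\<close>.\<close>

lemma ellK_imaginary_period: "ellK (C / D) = D * pi / 2"
proof -
  have k1: "(C / D)\<^sup>2 < 1" using theta_null_bounds by (simp add: power_less_one_iff)
  have udpos: "itheta_d l y > 0" for y using itheta_c_less_itheta_d[OF l, of y] by linarith
  have u0: "itheta_am l 0 = 0" and up: "itheta_am l pi = pi / 2"
    using itheta_am_int_pi[OF l, of 0] itheta_am_int_pi[OF l, of 1] by simp_all
  have mono: "itheta_am l x \<le> itheta_am l y" if "x \<le> y" for x y
    by (rule DERIV_nonneg_imp_nondecreasing[OF that])
      (use itheta_am_has_real_derivative[OF l] udpos in \<open>force intro: less_imp_le\<close>)
  have d: "((\<lambda>y. ellF (C / D) (itheta_am l y) - D * y / 2) has_real_derivative 0) (at y)"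
    if y: "0 \<le> y" "y \<le> pi" for y
  proof -
    have "0 \<le> itheta_am l y" "itheta_am l y \<le> pi / 2" using mono[of 0 y] mono[of y pi] y u0 up by auto
    then have bnd: "- pi < itheta_am l y" "itheta_am l y < pi" using pi_gt_zero by linarith+
    have "(itheta_d l y)\<^sup>2 = D\<^sup>2 - (itheta_s l y)\<^sup>2"
      using theta_imaginary_square[OF l, of y] by (simp add: D_def)
    then have "(itheta_d l y)\<^sup>2 = D\<^sup>2 - C\<^sup>2 * (sin (itheta_am l y))\<^sup>2"
      using itheta_s_amplitude[OF l, of y] by (simp add: C_def power_mult_distrib)
    then have "1 - (C / D)\<^sup>2 * (sin (itheta_am l y))\<^sup>2 = (itheta_d l y / D)\<^sup>2"
      using theta_null_bounds by (simp add: field_simps)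
    then have rt: "sqrt (1 - (C / D)\<^sup>2 * (sin (itheta_am l y))\<^sup>2) = itheta_d l y / D"
      using theta_null_bounds udpos[of y] by simp
    have "((\<lambda>y. ellF (C / D) (itheta_am l y)) has_real_derivative
        1 / sqrt (1 - (C / D)\<^sup>2 * (sin (itheta_am l y))\<^sup>2) * (itheta_d l y / 2)) (at y)"
      by (rule DERIV_chain2[OF ellF_has_real_derivative[OF k1 bnd] itheta_am_has_real_derivative[OF l]])
    also have "1 / sqrt (1 - (C / D)\<^sup>2 * (sin (itheta_am l y))\<^sup>2) * (itheta_d l y / 2) = D / 2"
      unfolding rt using udpos[of y] by simp
    finally show ?thesis by (auto intro!: derivative_eq_intros)
  qed
  have "ellF (C / D) (itheta_am l pi) - D * pi / 2 = ellF (C / D) (itheta_am l 0) - D * 0 / 2"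
  proof (rule DERIV_isconst_end[of 0 pi "\<lambda>y. ellF (C / D) (itheta_am l y) - D * y / 2"])
    show "continuous_on {0..pi} (\<lambda>y. ellF (C / D) (itheta_am l y) - D * y / 2)"
      using d by (intro DERIV_continuous_on[of _ _ "\<lambda>_. 0"]) (auto intro: has_field_derivative_at_within)
  qed (auto intro: d)
  then show ?thesis by (simp add: u0 up ellF_0 ellF_pi_half k1)
qed

text \<open>At \<open>l / 2\<close> both elliptic integrals equal \<open>D * l / 4\<close>, so their
  upper limits agree. The arctangents of \<open>rtheta_s / C\<close> and \<open>rtheta_s / D\<close>
  are then complementary angles, and their tangents multiply to 1.\<close>

lemma rtheta_s_midpoint: "(rtheta_s l (l / 2))\<^sup>2 = C * D" "rtheta_s l (l / 2) > 0"
proof -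
  have h: "\<bar>l / 2\<bar> < l" using l by simp
  let ?s = "rtheta_s l (l / 2)"
  have "ellF k (arctan (?s / C)) = ellF k (pi / 2 - arctan (?s / D))"
    unfolding ellF_arctan_rtheta_c[OF h] ellF_arctan_rtheta_d[OF h] ellK_real_period by simp
  moreover have "- pi < pi / 2 - arctan (?s / D)" "pi / 2 - arctan (?s / D) < pi"
    using arctan_lbound[of "?s / D"] arctan_ubound[of "?s / D"] pi_gt_zero by linarith+
  ultimately have "arctan (?s / C) = pi / 2 - arctan (?s / D)"
    by (rule ellF_inj[OF modulus_square(2) _ arctan_bounds_pi(1) _ arctan_bounds_pi(2)])
  then have "tan (arctan (?s / C)) = tan (pi / 2 - arctan (?s / D))" by simp
  then have e: "?s / C = inverse (?s / D)"
    by (simp add: tan_cot arctan)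
  have "?s \<noteq> 0"
  proof
    assume "?s = 0"
    then have "D * (l / 2) / 2 = 0" using ellF_arctan_rtheta_c[OF h] by (simp add: ellF_0)
    then show False using theta_null_bounds l by simp
  qed
  moreover have "?s \<ge> 0" using l by (intro rtheta_s_nonneg) auto
  ultimately show "?s > 0" by simp
  then show "?s\<^sup>2 = C * D" using e theta_null_bounds by (simp add: field_simps power2_eq_square)
qed

end

text \<open>The two period formulas give the quotient \<open>q\<close> of the null values the same
  ratio of complete integrals as \<open>kp\<close>. This ratio is strictly monotone in the modulus,
  so \<open>q = kp\<close>.\<close>

lemma theta_modulus:
  fixes kp :: real
  assumes kp: "0 < kp" "kp < 1"
  defines "l \<equiv> pi * ellK (sqrt (1 - kp\<^sup>2)) / ellK kp"
  shows "l > 0" "rtheta_c l 0 = kp * rtheta_d l 0" "rtheta_d l 0 = 2 * ellK kp / pi"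
proof -
  have kp2: "kp\<^sup>2 < 1" using kp by (simp add: power_less_one_iff)
  then have kc2: "(sqrt (1 - kp\<^sup>2))\<^sup>2 < 1" using kp by simp
  have Kpos: "ellK (sqrt (1 - kp\<^sup>2)) > 0" "ellK kp > 0" using ellK_pos[OF kp2] ellK_pos[OF kc2] by auto
  then show l: "l > 0" by (simp add: l_def)
  define q where "q = rtheta_c l 0 / rtheta_d l 0"
  have pos: "rtheta_c l 0 > 0" "rtheta_d l 0 > 0" using theta_real_pos[OF l, of 0] l by auto
  have q: "0 < q" "q < 1" using pos rtheta_c_less_rtheta_d[OF l] by (auto simp: q_def)
  have q2: "q\<^sup>2 < 1" using q by (simp add: power_less_one_iff)
  have P: "ellK (sqrt (1 - q\<^sup>2)) = rtheta_d l 0 * l / 2" "ellK q = rtheta_d l 0 * pi / 2"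
    using ellK_real_period[OF l] ellK_imaginary_period[OF l] by (simp_all add: q_def)
  have "ellK (sqrt (1 - q\<^sup>2)) * pi = l * ellK q" unfolding P by simp
  then have R: "ellK (sqrt (1 - q\<^sup>2)) * ellK kp = ellK (sqrt (1 - kp\<^sup>2)) * ellK q"
    using Kpos by (simp add: l_def field_simps)
  \<comment> \<open>The cross-multiplied monotonicity: \<open>ellK\<close> increases with the
    modulus, while its value at the complementary modulus decreases.\<close>
  have lt: "ellK (sqrt (1 - b\<^sup>2)) * ellK a < ellK (sqrt (1 - a\<^sup>2)) * ellK b"
    if ab: "0 < a" "a < b" "b < 1" for a b
  proof -
    have sq: "a\<^sup>2 < b\<^sup>2" "b\<^sup>2 < 1" using ab by (auto intro: power_strict_mono simp: power_less_one_iff)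
    have "ellK a < ellK b" using ab by (intro ellK_strict_mono) auto
    moreover have "ellK (sqrt (1 - b\<^sup>2)) < ellK (sqrt (1 - a\<^sup>2))"
      using sq ab by (intro ellK_strict_mono) auto
    moreover have "ellK (sqrt (1 - b\<^sup>2)) > 0" "ellK a > 0"
      using sq ab by (auto intro!: ellK_pos)
    ultimately show ?thesis by (intro mult_strict_mono) auto
  qed
  have "q = kp"
    using lt[of q kp] lt[of kp q] q kp R by (cases q kp rule: linorder_cases) (auto simp: mult.commute)
  then show "rtheta_c l 0 = kp * rtheta_d l 0" using pos by (simp add: q_def field_simps)
  show "rtheta_d l 0 = 2 * ellK kp / pi" using P(2) \<open>q = kp\<close> by (simp add: field_simps)
qed

section \<open>The derivative chain and orthogonality\<close>

lemma strip_summable_add: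
  assumes "strip_summable l A a" "strip_summable l A b"
  shows "strip_summable l A (\<lambda>t. a t + b t)"
  unfolding strip_summable_def
proof (intro allI impI)
  fix x :: real assume "\<bar>x\<bar> < l"
  then have "(\<lambda>t. \<bar>a t\<bar> * exp (t * x) + \<bar>b t\<bar> * exp (t * x)) summable_on A"
    using assms by (intro summable_on_add) (auto simp: strip_summable_def)
  then show "(\<lambda>t. \<bar>a t + b t\<bar> * exp (t * x)) summable_on A"
    by (rule summable_on_comparison_test) (auto simp: distrib_right[symmetric] intro!: mult_right_mono)
qed

lemma has_sum_real_exp_series:
  assumes "strip_summable l A a" "\<bar>x\<bar> < l"
  shows "((\<lambda>t. a t * exp (t * x)) has_sum Re (exp_series A a (of_real x))) A"
proof -
  have "\<bar>Re (of_real x)\<bar> < l" using assms by simp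
  from has_sum_Re[OF exp_series_has_sum[OF assms(1) this]] show ?thesis
    by (simp add: Re_exp)
qed

text \<open>Carries a closed form \<open>f\<close> of the sum over to the differentiated series:
  both functions agree on the whole interval, so their derivatives agree.\<close>

lemma has_sum_exp_series_derivative:
  assumes a: "strip_summable l A a"
    and f: "\<And>x. \<bar>x\<bar> < l \<Longrightarrow> ((\<lambda>t. a t * exp (t * x)) has_sum f x) A"
    and f': "(f has_real_derivative f') (at x)" and x: "\<bar>x\<bar> < l"
  shows "((\<lambda>t. t * a t * exp (t * x)) has_sum f') A"
proof -
  have x': "\<bar>Re (of_real x)\<bar> < l" using x by simp
  have "((\<lambda>x. Re (exp_series A a (of_real x))) has_real_derivative
      Re (exp_series A (\<lambda>t. t * a t) (of_real x))) (at x)"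
    by (rule Re_along_real_axis[OF exp_series_has_field_derivative[OF a x']])
  then have "(f has_real_derivative Re (exp_series A (\<lambda>t. t * a t) (of_real x))) (at x)"
  proof (rule has_field_derivative_transform_within_open[where S = "{- l<..<l}"])
    fix y assume "y \<in> {- l<..<l}"
    then have y: "\<bar>y\<bar> < l" by auto
    show "Re (exp_series A a (of_real y)) = f y"
      using has_sum_unique[OF has_sum_real_exp_series[OF a y] f[OF y]] .
  qed (use x in auto)
  then have "f' = Re (exp_series A (\<lambda>t. t * a t) (of_real x))" using f' by (rule DERIV_unique[symmetric])
  then show ?thesis using has_sum_real_exp_series[OF strip_summable_mult[OF a] x] by simp
qed

text \<open>With \<open>s, c, d\<close> standing for \<open>sc, nc, dc\<close>, \<open>chain p n\<close> is \<open>P_n(d/dz) nc / n!\<close>. The fourth iterate is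
  \<open>nc\<close> times an elliptic function with a fourfold zero at the quarter period: this is the period 4 of
  the recurrence coefficients.\<close>

definition chain_base :: "real \<Rightarrow> nat \<Rightarrow> real \<Rightarrow> real \<Rightarrow> real \<Rightarrow> real" where
  "chain_base p i s c d =
    (if i = 0 then c
     else if i = 1 then s * d - c
     else if i = 2 then (1 + p\<^sup>2 * s\<^sup>2) * c - (1 + p) * s * d
     else (p + 2 * p\<^sup>2 + p\<^sup>2 * s\<^sup>2) * s * d - (p + p\<^sup>2 * (1 + 2 * p) * s\<^sup>2) * c)"

definition chain_ratio :: "real \<Rightarrow> real \<Rightarrow> real \<Rightarrow> real \<Rightarrow> real" where
  "chain_ratio p s c d = p\<^sup>2 * (1 + 2 * (1 + p + p\<^sup>2) * s\<^sup>2 + p\<^sup>2 * s^4) - 2 * p\<^sup>2 * (1 + p) * s * c * d"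

definition chain :: "real \<Rightarrow> nat \<Rightarrow> real \<Rightarrow> real \<Rightarrow> real \<Rightarrow> real" where
  "chain p n s c d = chain_ratio p s c d ^ (n div 4) * chain_base p (n mod 4) s c d"

text \<open>This and \<open>chain_base_deriv\<close> are the formal derivatives under
  \<open>s' = c * d\<close>, \<open>c' = s * d\<close>,
  \<open>d' = p\<^sup>2 * s * c\<close>.\<close>

definition chain_ratio_deriv :: "real \<Rightarrow> real \<Rightarrow> real \<Rightarrow> real \<Rightarrow> real" where
  "chain_ratio_deriv p s c d = p\<^sup>2 * (4 * (1 + p + p\<^sup>2) * s + 4 * p\<^sup>2 * s^3) * (c * d)
     - 2 * p\<^sup>2 * (1 + p) * (c\<^sup>2 * d\<^sup>2 + s\<^sup>2 * d\<^sup>2 + p\<^sup>2 * s\<^sup>2 * c\<^sup>2)"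

definition chain_base_deriv :: "real \<Rightarrow> nat \<Rightarrow> real \<Rightarrow> real \<Rightarrow> real \<Rightarrow> real" where
  "chain_base_deriv p i s c d =
    (if i = 0 then s * d
     else if i = 1 then c * d * d + s * (p\<^sup>2 * s * c) - s * d
     else if i = 2 then p\<^sup>2 * (2 * s * (c * d)) * c + (1 + p\<^sup>2 * s\<^sup>2) * (s * d)
        - (1 + p) * (c * d * d + s * (p\<^sup>2 * s * c))
     else p\<^sup>2 * (2 * s * (c * d)) * s * d + (p + 2 * p\<^sup>2 + p\<^sup>2 * s\<^sup>2) * (c * d * d + s * (p\<^sup>2 * s * c))
        - (p\<^sup>2 * (1 + 2 * p) * (2 * s * (c * d)) * c + (p + p\<^sup>2 * (1 + 2 * p) * s\<^sup>2) * (s * d)))"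

section \<open>Algebraic identities behind the recurrence\<close>

context
  fixes p s c d :: real
  assumes c2: "c\<^sup>2 = 1 + s\<^sup>2" and d2: "d\<^sup>2 = 1 + p\<^sup>2 * s\<^sup>2"
begin

text \<open>The recurrence at n = 0, 1, 2, 3 after division by n!, so that the coefficients are n +
  1, b_n and u_n / n. The product \<open>chain_ratio * chain_base 0\<close> in the last line is the
  fourth member of the chain.\<close>

lemma chain_base_deriv_identities:
  "chain_base_deriv p 0 s c d = chain_base p 1 s c d + chain_base p 0 s c d"
  "chain_base_deriv p 1 s c d = 2 * chain_base p 2 s c d + (2 * p + 1) * chain_base p 1 s c d + 2 * p * chain_base p 0 s c d"
  "chain_base_deriv p 2 s c d = 3 * chain_base p 3 s c d + (4 * p + 1) * chain_base p 2 s c d + 2 * (1 + p) * chain_base p 1 s c d"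
  "chain_base_deriv p 3 s c d = 4 * chain_ratio p s c d * chain_base p 0 s c d + (2 * p + 5) * chain_base p 3 s c d + 6 * p * chain_base p 2 s c d"
  unfolding chain_base_deriv_def chain_base_def chain_ratio_def using c2 d2 by simp_all algebra+

text \<open>The coefficients n + 1, b_n and u_n / n are affine in n on each residue class modulo 4.
  These identities contain their increments when n grows by 4, so together with the four initial
  cases they give every n.\<close>

lemma chain_ratio_deriv_identities:
  "chain_ratio_deriv p s c d * chain_base p 0 s c d = 4 * chain_ratio p s c d * chain_base p 1 s c d + 2 * (p + 3) * chain_ratio p s c d * chain_base p 0 s c d
     + 4 * p * (p + 1) * chain_base p 3 s c d"
  "chain_ratio_deriv p s c d * chain_base p 1 s c d = chain_ratio p s c d * (4 * chain_base p 2 s c d + 2 * (3 * p + 1) * chain_base p 1 s c d + 8 * p * chain_base p 0 s c d)"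
  "chain_ratio_deriv p s c d * chain_base p 2 s c d = chain_ratio p s c d * (4 * chain_base p 3 s c d + 2 * (3 * p + 1) * chain_base p 2 s c d + 4 * (1 + p) * chain_base p 1 s c d)"
  "chain_ratio_deriv p s c d * chain_base p 3 s c d = chain_ratio p s c d * (4 * chain_ratio p s c d * chain_base p 0 s c d + 2 * (p + 3) * chain_base p 3 s c d + 8 * p * chain_base p 2 s c d)"
  unfolding chain_ratio_deriv_def chain_base_def chain_ratio_def using c2 d2 by simp_all algebra+

end

lemma chain_factors_has_real_derivative:
  assumes s: "(s has_real_derivative m * (c x * d x)) (at x)"
    and c: "(c has_real_derivative m * (s x * d x)) (at x)"
    and d: "(d has_real_derivative m * (p\<^sup>2 * s x * c x)) (at x)"
  shows "((\<lambda>x. chain_ratio p (s x) (c x) (d x)) has_real_derivative m * chain_ratio_deriv p (s x) (c x) (d x)) (at x)"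
    and "((\<lambda>x. chain_base p i (s x) (c x) (d x)) has_real_derivative m * chain_base_deriv p i (s x) (c x) (d x)) (at x)"
proof -
  show "((\<lambda>x. chain_ratio p (s x) (c x) (d x)) has_real_derivative m * chain_ratio_deriv p (s x) (c x) (d x)) (at x)"
    unfolding chain_ratio_def chain_ratio_deriv_def
    by (rule derivative_eq_intros s c d refl)+ (simp add: algebra_simps power2_eq_square power3_eq_cube)
  show "((\<lambda>x. chain_base p i (s x) (c x) (d x)) has_real_derivative m * chain_base_deriv p i (s x) (c x) (d x)) (at x)"
    unfolding chain_base_def chain_base_deriv_def
    by (cases "i = 0"; cases "i = 1"; cases "i = 2"; simp;
        (rule derivative_eq_intros s c d refl)+; simp add: algebra_simps power2_eq_square)
qed

text \<open>The left side is the product rule for \<open>T ^ j * E i\<close>, grouped so that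
  \<open>T' * E i\<close> appears as a unit for \<open>chain_ratio_deriv_identities\<close>.\<close>

lemma chain_deriv_identity:
  assumes c2: "c\<^sup>2 = 1 + s\<^sup>2" and d2: "d\<^sup>2 = 1 + p\<^sup>2 * s\<^sup>2"
  shows "fact n * (real (n div 4) * chain_ratio p s c d ^ (n div 4 - 1) * (chain_ratio_deriv p s c d * chain_base p (n mod 4) s c d)
      + chain_ratio p s c d ^ (n div 4) * chain_base_deriv p (n mod 4) s c d)
    = fact (Suc n) * chain p (Suc n) s c d + bcoef p n * (fact n * chain p n s c d)
      + ucoef p n * (fact (n - 1) * chain p (n - 1) s c d)"
proof -
  define j i where "j = n div 4" and "i = n mod 4"
  have n: "n = 4 * j + i" by (simp add: i_def j_def)
  define T T' where "T = chain_ratio p s c d" and "T' = chain_ratio_deriv p s c d"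
  define E where "E i = chain_base p i s c d" for i
  have ch: "chain p (4 * q + r) s c d = T ^ q * E r" if "r < 4" for q r
    using that by (simp add: chain_def T_def E_def)
  have fs: "fact (Suc n) = (real n + 1) * (fact n :: real)" by simp
  \<comment> \<open>\<open>ucoef p n\<close> contains the square of \<open>n\<close>: one factor
    completes \<open>fact (n - 1)\<close> to \<open>fact n\<close>, the other stays as
    coefficient.\<close>
  have fp: "real n * fact (n - 1) = (fact n :: real)" if "n > 0"
    using that fact_reduce[of n, where ?'a = real] by simp
  have Tj: "real j * T ^ (j - 1) * (T * y) = real j * T ^ j * y" for y
    by (cases j) simp_all
  note B = chain_base_deriv_identities[OF assms, folded T_def E_def]
  note R = chain_ratio_deriv_identities[OF assms, folded T_def T'_def E_def]
  have "i < 4" by (simp add: i_def)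
  then have "i = 0 \<or> i = 1 \<or> i = 2 \<or> i = 3" by linarith
  \<comment> \<open>For \<open>i = 0\<close> the predecessor lies in the previous block and has one
    power of \<open>T\<close> less, which calls for \<open>j = Suc j'\<close>. At
    \<open>n = 0\<close> the truncated predecessor is cancelled by
    \<open>ucoef p 0 = 0\<close>.\<close>
  then consider "i = 0" "j = 0" | j' where "i = 0" "j = Suc j'" | "i = 1" | "i = 2" | "i = 3"
    by (cases j) auto
  then show ?thesis
  proof cases
    case 1
    then have "n = 0" using n by simp
    then show ?thesis using B(1)
      by (simp add: E_def chain_def bcoef_def ucoef_def)
  next
    case (2 j')
    then have n': "Suc n = 4 * j + 1" "n = 4 * j + 0" "n - 1 = 4 * j' + 3" "n > 0" "n div 4 = j" "n mod 4 = 0"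
        "j - 1 = j'" and rn: "real n = 4 * real j"
      using n by auto
    have u: "ucoef p n * (fact (n - 1) * y) = p * (p + 1) * real n * (fact n * y)" for y
      unfolding fp[OF n'(4), symmetric] using n'(6) by (simp add: ucoef_def power2_eq_square)
    have b: "bcoef p n = (p + 3) * real n / 2 + 1" using n' by (simp add: bcoef_def)
    have c: "chain p (Suc n) s c d = T ^ j * E 1" "chain p n s c d = T ^ j * E 0" "chain p (n - 1) s c d = T ^ j' * E 3"
      unfolding n'(1) n'(3) using ch[of 1 j] ch[of 0 j] ch[of 3 j'] n'(2) by simp_all
    have TT: "T ^ j = T ^ j' * T" using 2 by simp
    show ?thesis
      unfolding u b c fs n'(5) n'(6) n'(7) T_def[symmetric] T'_def[symmetric] E_def[symmetric] B R TT rn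
      by (simp add: field_simps)
  next
    case 3
    then have n': "Suc n = 4 * j + 2" "n = 4 * j + 1" "n - 1 = 4 * j + 0" "n > 0" "n div 4 = j" "n mod 4 = 1"
      and rn: "real n = 4 * real j + 1"
      using n by simp_all
    have u: "ucoef p n * (fact (n - 1) * y) = 2 * p * real n * (fact n * y)" for y
      unfolding fp[OF n'(4), symmetric] using n'(6) by (simp add: ucoef_def power2_eq_square)
    have b: "bcoef p n = (3 * p + 1) * real n / 2 + (p + 1) / 2" using n' by (simp add: bcoef_def)
    have c: "chain p (Suc n) s c d = T ^ j * E 2" "chain p n s c d = T ^ j * E 1" "chain p (n - 1) s c d = T ^ j * E 0"
      unfolding n'(1) n'(3) using ch[of 2 j] ch[of 1 j] ch[of 0 j] n'(2) by simp_all
    show ?thesis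
      unfolding u b c fs n'(5) n'(6) T_def[symmetric] T'_def[symmetric] E_def[symmetric] B R Tj rn
      by (simp add: field_simps)
  next
    case 4
    have n2: "n mod 4 = 2" using 4 by (simp add: i_def)
    have n': "Suc n = 4 * j + 3" "n = 4 * j + 2" "n - 1 = 4 * j + 1" "n > 0" "n div 4 = j"
      and rn: "real n = 4 * real j + 2"
      using n 4 by simp_all
    have u: "ucoef p n * (fact (n - 1) * y) = (1 + p) * real n * (fact n * y)" for y
      unfolding fp[OF n'(4), symmetric] using n2 by (simp add: ucoef_def power2_eq_square)
    have b: "bcoef p n = (3 * p + 1) * real n / 2 + p" using n2 by (simp add: bcoef_def)
    have c: "chain p (Suc n) s c d = T ^ j * E 3" "chain p n s c d = T ^ j * E 2" "chain p (n - 1) s c d = T ^ j * E 1"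
      unfolding n'(1) n'(3) using ch[of 3 j] ch[of 2 j] ch[of 1 j] n'(2) by simp_all
    show ?thesis
      unfolding u b c fs n'(5) n2 T_def[symmetric] T'_def[symmetric] E_def[symmetric] B R Tj rn
      by (simp add: field_simps)
  next
    case 5
    then have n': "Suc n = 4 * Suc j + 0" "n = 4 * j + 3" "n - 1 = 4 * j + 2" "n > 0" "n div 4 = j" "n mod 4 = 3"
      and rn: "real n = 4 * real j + 3"
      using n by simp_all
    have u: "ucoef p n * (fact (n - 1) * y) = 2 * p * real n * (fact n * y)" for y
      unfolding fp[OF n'(4), symmetric] using n'(6) by (simp add: ucoef_def power2_eq_square)
    have b: "bcoef p n = (p + 3) * real n / 2 + (p + 1) / 2" using n' by (simp add: bcoef_def)
    have c: "chain p (Suc n) s c d = T ^ j * (T * E 0)" "chain p n s c d = T ^ j * E 3" "chain p (n - 1) s c d = T ^ j * E 2"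
      unfolding n'(1) n'(3) using ch[of 0 "Suc j"] ch[of 3 j] ch[of 2 j] n'(2) by simp_all
    show ?thesis
      unfolding u b c fs n'(5) n'(6) T_def[symmetric] T'_def[symmetric] E_def[symmetric] B R Tj rn
      by (simp add: field_simps)
  qed
qed

lemma chain_has_real_derivative:
  assumes s: "(s has_real_derivative m * (c x * d x)) (at x)"
    and c: "(c has_real_derivative m * (s x * d x)) (at x)"
    and d: "(d has_real_derivative m * (p\<^sup>2 * s x * c x)) (at x)"
    and c2: "(c x)\<^sup>2 = 1 + (s x)\<^sup>2" and d2: "(d x)\<^sup>2 = 1 + p\<^sup>2 * (s x)\<^sup>2"
  shows "((\<lambda>x. fact n * chain p n (s x) (c x) (d x)) has_real_derivative
     m * (fact (Suc n) * chain p (Suc n) (s x) (c x) (d x) + bcoef p n * (fact n * chain p n (s x) (c x) (d x))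
      + ucoef p n * (fact (n - 1) * chain p (n - 1) (s x) (c x) (d x)))) (at x)"
  unfolding chain_deriv_identity[OF c2 d2, symmetric]
  unfolding chain_def
  by (rule derivative_eq_intros chain_factors_has_real_derivative s c d refl)+ (simp add: algebra_simps)

section \<open>The polynomials applied to the generating function, and its value at the quarter
  period\<close>

lemma Ppoly_Suc: "Ppoly p (Suc n) x = (x - bcoef p n) * Ppoly p n x - ucoef p n * Ppoly p (n - 1) x"
  by (cases n) (simp_all add: ucoef_def)

text \<open>The frequency \<open>t\<close> belongs to the node \<open>2 * t / rtheta_d l 0\<close>.
  Multiplying coefficients by the node is differentiation with respect to the rescaled argument, so
  the recurrence of \<open>Ppoly\<close> and the derivative of \<open>chain\<close> advance in
  step.\<close>

lemma has_sum_chain: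
  fixes p l :: real
  assumes p: "0 < p" and l: "l > 0" and CD: "rtheta_c l 0 = p * rtheta_d l 0" and x: "\<bar>x\<bar> < l"
  shows "((\<lambda>t. Ppoly p n (2 * t / rtheta_d l 0) * (1 / (rtheta_c l 0 * cosh (t * l))) * exp (t * x)) has_sum
      fact n * chain p n (rtheta_s l x / rtheta_c l 0) (rtheta_c l x / rtheta_c l 0) (rtheta_d l x / rtheta_d l 0)) half_ints"
proof -
  define C D where "C = rtheta_c l 0" and "D = rtheta_d l 0"
  define a where "a = (\<lambda>n t. Ppoly p n (2 * t / D) * (1 / (C * cosh (t * l))))"
  define f where "f = (\<lambda>n x. fact n * chain p n (rtheta_s l x / C) (rtheta_c l x / C) (rtheta_d l x / D))"
  have pos: "C > 0" "D > 0" "C = p * D"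
    using theta_real_pos[OF l, of 0] l CD by (auto simp: C_def D_def)
  have aS: "a (Suc n) t = (2 / D) * (t * a n t) + (- bcoef p n * a n t + - ucoef p n * a (n - 1) t)" for n t
    unfolding a_def Ppoly_Suc by (simp add: algebra_simps)
  \<comment> \<open>The recurrence looks back two places, so the induction carries all
    \<open>m \<le> n\<close>; it carries all \<open>x\<close> in the interval because the closed
    form is differentiated.\<close>
  have "(\<forall>m\<le>n. strip_summable l half_ints (a m) \<and>
      (\<forall>x. \<bar>x\<bar> < l \<longrightarrow> ((\<lambda>t. a m t * exp (t * x)) has_sum f m x) half_ints))"
  proof (induction n)
    case 0
    have a0: "a 0 = (\<lambda>t. (1 / C) * (1 / cosh (t * l)))" by (simp add: a_def)
    have st: "strip_summable l half_ints (a 0)"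
      unfolding a0 by (rule strip_summable_cmult[OF strip_summable_cosh])
    have "((\<lambda>t. a 0 t * exp (t * x)) has_sum f 0 x) half_ints" if x: "\<bar>x\<bar> < l" for x
    proof -
      from has_sum_cmult_right[OF has_sum_real_exp_series[OF strip_summable_cosh[of l "- (1/2)"] x], of "1 / C"]
      show ?thesis
        by (simp add: a0 f_def chain_def chain_base_def rtheta_c_def theta_c_def)
    qed
    with st show ?case by simp
  next
    case (Suc n)
    then have st: "strip_summable l half_ints (a n)" "strip_summable l half_ints (a (n - 1))"
      and sm: "\<And>x. \<bar>x\<bar> < l \<Longrightarrow> ((\<lambda>t. a n t * exp (t * x)) has_sum f n x) half_ints"
        "\<And>x. \<bar>x\<bar> < l \<Longrightarrow> ((\<lambda>t. a (n - 1) t * exp (t * x)) has_sum f (n - 1) x) half_ints"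
      by auto
    have stS: "strip_summable l half_ints (a (Suc n))"
      unfolding aS[abs_def] by (intro strip_summable_add strip_summable_cmult strip_summable_mult st)
    have "((\<lambda>t. a (Suc n) t * exp (t * x)) has_sum f (Suc n) x) half_ints" if x: "\<bar>x\<bar> < l" for x
    proof -
      have sq: "(rtheta_c l x / C)\<^sup>2 = 1 + (rtheta_s l x / C)\<^sup>2" "(rtheta_d l x / D)\<^sup>2 = 1 + p\<^sup>2 * (rtheta_s l x / C)\<^sup>2"
        using theta_real_squares[OF l x, folded C_def D_def] pos p
        by (simp_all add: power_divide field_simps power_mult_distrib)
      have "(f n has_real_derivative D / 2 * (f (Suc n) x + bcoef p n * f n x + ucoef p n * f (n - 1) x)) (at x)"
        unfolding f_def
      proof (rule chain_has_real_derivative[where s = "\<lambda>x. rtheta_s l x / C" and c = "\<lambda>x. rtheta_c l x / C" and d = "\<lambda>x. rtheta_d l x / D", OF _ _ _ sq])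
        show "((\<lambda>x. rtheta_s l x / C) has_real_derivative D / 2 * (rtheta_c l x / C * (rtheta_d l x / D))) (at x)"
          by (rule DERIV_cong[OF DERIV_cdivide[OF theta_real_derivatives(2)[OF l x]]]) (use pos in simp)
        show "((\<lambda>x. rtheta_c l x / C) has_real_derivative D / 2 * (rtheta_s l x / C * (rtheta_d l x / D))) (at x)"
          by (rule DERIV_cong[OF DERIV_cdivide[OF theta_real_derivatives(1)[OF l x]]]) (use pos in simp)
        show "((\<lambda>x. rtheta_d l x / D) has_real_derivative D / 2 * (p\<^sup>2 * (rtheta_s l x / C) * (rtheta_c l x / C))) (at x)"
          by (rule DERIV_cong[OF DERIV_cdivide[OF theta_real_derivatives(3)[OF l x]]])
            (use pos p in \<open>simp add: power2_eq_square\<close>)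
      qed
      from has_sum_exp_series_derivative[OF st(1) sm(1) this x]
      have "((\<lambda>t. t * a n t * exp (t * x)) has_sum
          D / 2 * (f (Suc n) x + bcoef p n * f n x + ucoef p n * f (n - 1) x)) half_ints" .
      then have "((\<lambda>t. (2 / D) * (t * a n t * exp (t * x)) + (- bcoef p n * (a n t * exp (t * x)) + - ucoef p n * (a (n - 1) t * exp (t * x))))
         has_sum (2 / D) * (D / 2 * (f (Suc n) x + bcoef p n * f n x + ucoef p n * f (n - 1) x))
           + (- bcoef p n * f n x + - ucoef p n * f (n - 1) x)) half_ints"
        by (intro has_sum_add has_sum_cmult_right sm x)
      also have "(2 / D) * (D / 2 * (f (Suc n) x + bcoef p n * f n x + ucoef p n * f (n - 1) x))
           + (- bcoef p n * f n x + - ucoef p n * f (n - 1) x) = f (Suc n) x"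
        using pos by (simp add: field_simps)
      finally show ?thesis unfolding aS by (simp add: algebra_simps)
    qed
    with stS Suc show ?case by (auto simp: le_Suc_eq)
  qed
  then show ?thesis using x by (simp add: a_def f_def C_def D_def)
qed

text \<open>These are the values of sc, nc, dc at the quarter period. There
  \<open>s * d = c\<close>, since both are positive with equal squares; substituting this and
  \<open>s\<^sup>2 = 1 / p\<close> annihilates \<open>chain_ratio\<close> and all
  \<open>chain_base p i\<close> with \<open>i \<noteq> 0\<close>.\<close>

lemma chain_midpoint:
  fixes p s c d :: real
  assumes p: "0 < p" and pos: "s > 0" "c > 0" "d > 0"
    and sq: "s\<^sup>2 = 1 / p" "c\<^sup>2 = 1 + s\<^sup>2" "d\<^sup>2 = 1 + p\<^sup>2 * s\<^sup>2"
  shows "chain p n s c d = (if n = 0 then sqrt ((1 + p) / p) else 0)"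
proof -
  have c2: "c\<^sup>2 = (1 + p) / p" and d2: "d\<^sup>2 = 1 + p"
    using p unfolding sq by (simp_all add: field_simps power2_eq_square)
  have c: "c = sqrt ((1 + p) / p)" using pos c2 by (metis less_imp_le real_sqrt_unique)
  have "(s * d)\<^sup>2 = c\<^sup>2" unfolding power_mult_distrib c2 d2 sq(1) by simp
  then have sd: "s * d = c" using pos by (auto intro: power2_eq_imp_eq)
  have E: "chain_base p i s c d = 0" if "i \<noteq> 0" for i
    using that p unfolding chain_base_def mult.assoc sd sq(1) by (simp add: field_simps power2_eq_square)
  have "s * c * d = c\<^sup>2" using sd by (simp add: power2_eq_square mult_ac)
  moreover have "s ^ 4 = 1 / p\<^sup>2"
    using sq(1) by (metis (no_types) num_double numeral_times_numeral power_mult power_one_over)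
  ultimately have T: "chain_ratio p s c d = 0"
    using p unfolding chain_ratio_def mult.assoc[of _ s] mult.assoc[of s] by (simp add: c2 sq(1)) (simp add: field_simps power2_eq_square)
  show ?thesis
  proof (cases "n mod 4 = 0")
    case True
    then show ?thesis
    proof (cases "n = 0")
      case False
      with True have "n div 4 > 0" by presburger
      then show ?thesis using False T by (simp add: chain_def)
    qed (simp add: chain_def chain_base_def c)
  qed (auto simp: chain_def E)
qed

text \<open>Multiplication by the variable is symmetric, so the recurrence lowers the smaller index
  at the expense of the larger one until the sums of \<open>M s * Ppoly p n (x s)\<close>
  decide.\<close>

lemma Ppoly_orthogonal:
  fixes M x :: "'i \<Rightarrow> real" and p c0 :: real
  assumes M: "\<And>n. ((\<lambda>s. M s * Ppoly p n (x s)) has_sum (if n = 0 then c0 else 0)) A"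
    and "m \<le> n"
  shows "((\<lambda>s. M s * Ppoly p m (x s) * Ppoly p n (x s)) has_sum
     (if n = m then c0 * (\<Prod>i=1..m. ucoef p i) else 0)) A"
proof -
  define h where "h = (\<lambda>m. c0 * (\<Prod>i=1..m. ucoef p i))"
  have "\<forall>k\<le>m. \<forall>n\<ge>k. ((\<lambda>s. M s * Ppoly p k (x s) * Ppoly p n (x s)) has_sum (if n = k then h k else 0)) A"
  proof (induction m)
    case 0
    show ?case
    proof (intro allI impI)
      fix k n :: nat assume "k \<le> 0"
      then show "((\<lambda>s. M s * Ppoly p k (x s) * Ppoly p n (x s)) has_sum (if n = k then h k else 0)) A"
        using M[of n] by (cases "n = 0") (simp_all add: h_def)
    qed
  next
    case (Suc m)
    have "((\<lambda>s. M s * Ppoly p (Suc m) (x s) * Ppoly p n (x s)) has_sum (if n = Suc m then h (Suc m) else 0)) A"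
      if n: "n \<ge> Suc m" for n
    proof -
      have IH: "((\<lambda>s. M s * Ppoly p k (x s) * Ppoly p q (x s)) has_sum (if q = k then h k else 0)) A"
        if "k \<le> m" "k \<le> q" for k q using Suc that by blast
      let ?P = "\<lambda>k s. Ppoly p k (x s)"
      \<comment> \<open>Eliminate the variable between the recurrences at \<open>m\<close> and at
        \<open>n\<close> to express the product for \<open>Suc m\<close> and \<open>n\<close>. For
        \<open>n \<ge> Suc m\<close> only the term with \<open>n - 1\<close> can survive, exactly
        when \<open>n = Suc m\<close>, and it contributes \<open>ucoef p n * h m\<close>.\<close>
      have "((\<lambda>s. M s * ?P m s * ?P (Suc n) s + ((bcoef p n - bcoef p m) * (M s * ?P m s * ?P n s)
            + (ucoef p n * (M s * ?P m s * ?P (n - 1) s) + - ucoef p m * (M s * ?P (m - 1) s * ?P n s))))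
          has_sum (if Suc n = m then h m else 0) + ((bcoef p n - bcoef p m) * (if n = m then h m else 0)
            + (ucoef p n * (if n - 1 = m then h m else 0) + - ucoef p m * (if n = m - 1 then h (m - 1) else 0)))) A"
        using n by (intro has_sum_add has_sum_cmult_right IH) auto
      also have "(\<lambda>s. M s * ?P m s * ?P (Suc n) s + ((bcoef p n - bcoef p m) * (M s * ?P m s * ?P n s)
            + (ucoef p n * (M s * ?P m s * ?P (n - 1) s) + - ucoef p m * (M s * ?P (m - 1) s * ?P n s))))
          = (\<lambda>s. M s * ?P (Suc m) s * ?P n s)"
        unfolding Ppoly_Suc by (simp add: algebra_simps)
      also have "(if Suc n = m then h m else 0) + ((bcoef p n - bcoef p m) * (if n = m then h m else 0)
            + (ucoef p n * (if n - 1 = m then h m else 0) + - ucoef p m * (if n = m - 1 then h (m - 1) else 0)))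
          = (if n = Suc m then h (Suc m) else 0)"
        using n by (auto simp: h_def)
      finally show ?thesis .
    qed
    with Suc show ?case by (auto simp: le_Suc_eq)
  qed
  then have "((\<lambda>s. M s * Ppoly p m (x s) * Ppoly p n (x s)) has_sum (if n = m then h m else 0)) A"
    using \<open>m \<le> n\<close> by blast
  then show ?thesis unfolding h_def .
qed

theorem theorem2:
  fixes kp :: real and n m :: nat
  assumes "0 < kp" and "kp < 1"
  defines "k \<equiv> sqrt (1 - kp^2)"
  defines "v \<equiv> exp (- pi * ellK k / ellK kp)"
  defines "xs \<equiv> (\<lambda>s::int. pi * (real_of_int s - 1/2) / ellK kp)"
  defines "Ms \<equiv> (\<lambda>s::int. pi / (kp * ellK kp) *
              (v powr (- (real_of_int s - 1/2) / 2) /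
               (v powr (real_of_int s - 1/2) + v powr (1/2 - real_of_int s))))"
  defines "h \<equiv> (\<lambda>j::nat. sqrt ((1 + kp) / kp) * (\<Prod>i=1..j. ucoef kp i))"
  shows "((\<lambda>s::int. Ms s * Ppoly kp n (xs s) * Ppoly kp m (xs s))
           has_sum (if n = m then h n else 0)) UNIV"
proof -
  define l where "l = pi * ellK (sqrt (1 - kp\<^sup>2)) / ellK kp"
  note th = theta_modulus[OF assms(1,2), folded l_def]
  define C D where "C = rtheta_c l 0" and "D = rtheta_d l 0"
  have l: "l > 0" and CD: "C = kp * D" and D: "D = 2 * ellK kp / pi"
    using th by (simp_all add: C_def D_def)
  have Cpos: "C > 0" "D > 0"
    using theta_real_pos[OF l, of 0] l by (auto simp: C_def D_def)
  then have Kpos: "ellK kp > 0" using D by (simp add: zero_less_divide_iff)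
  have h: "\<bar>l / 2\<bar> < l" using l by simp
  have v: "v powr y = exp (- (y * l))" for y
    by (simp add: v_def k_def l_def powr_def)
  \<comment> \<open>With \<open>t = s - 1/2\<close> the denominator gives the coefficient of the
    generating function at frequency \<open>t\<close>, and the numerator
    \<open>v powr (- t / 2)\<close> is the exponential evaluated at the midpoint
    \<open>l / 2\<close>.\<close>
  have M: "Ms s = 1 / (C * cosh ((real_of_int s + - (1/2)) * l)) * exp ((real_of_int s + - (1/2)) * (l / 2))" for s
  proof -
    have "v powr (real_of_int s - 1/2) + v powr (1/2 - real_of_int s) = 2 * cosh ((real_of_int s + - (1/2)) * l)"
      unfolding v by (simp add: cosh_field_def algebra_simps)
    moreover have "v powr (- (real_of_int s - 1/2) / 2) = exp ((real_of_int s + - (1/2)) * (l / 2))"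
      unfolding v by (simp add: field_simps)
    moreover have "pi / (kp * ellK kp) = 2 / C"
      using assms(1) Kpos by (simp add: CD D)
    ultimately show ?thesis unfolding Ms_def by simp
  qed
  have x: "xs s = 2 * (real_of_int s + - (1/2)) / D" for s
    unfolding xs_def D using Kpos by (simp add: field_simps)
  define s c d where "s = rtheta_s l (l / 2) / C" and "c = rtheta_c l (l / 2) / C" and "d = rtheta_d l (l / 2) / D"
  have pos: "s > 0" "c > 0" "d > 0"
    using rtheta_s_midpoint(2)[OF l] theta_real_pos[OF l h] Cpos by (simp_all add: s_def c_def d_def)
  have "s\<^sup>2 = 1 / kp"
    using rtheta_s_midpoint(1)[OF l] Cpos CD assms(1)
    by (simp add: s_def C_def[symmetric] D_def[symmetric] power_divide) (simp add: power2_eq_square)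
  moreover have "c\<^sup>2 = 1 + s\<^sup>2" "d\<^sup>2 = 1 + kp\<^sup>2 * s\<^sup>2"
    using theta_real_squares[OF l h, folded C_def D_def] Cpos CD assms(1)
    by (simp_all add: s_def c_def d_def power_divide field_simps power_mult_distrib)
  ultimately have mid: "chain kp n s c d = (if n = 0 then sqrt ((1 + kp) / kp) else 0)" for n
    using chain_midpoint[OF assms(1) pos] by blast
  have base: "((\<lambda>s. Ms s * Ppoly kp n (xs s)) has_sum (if n = 0 then sqrt ((1 + kp) / kp) else 0)) UNIV" for n
  proof -
    have "((\<lambda>t. Ppoly kp n (2 * t / D) * (1 / (C * cosh (t * l))) * exp (t * (l / 2))) has_sum
        fact n * chain kp n s c d) half_ints"
      using has_sum_chain[OF assms(1) l th(2) h, of n] by (simp add: C_def D_def s_def c_def d_def)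
    then show ?thesis unfolding has_sum_shifted_ints_iff mid M x by (cases "n = 0") (simp_all add: mult_ac)
  qed
  show ?thesis
  proof (cases "m \<le> n")
    case True
    from Ppoly_orthogonal[OF base this] show ?thesis by (auto simp: h_def mult_ac)
  next
    case False
    then have "n \<le> m" by simp
    from Ppoly_orthogonal[OF base this] False show ?thesis by (auto simp: h_def mult_ac)
  qed
qed

end
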